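(* Let $b_+,b_->0$, $\delta_\pm\in\mathbb R$ with $b_\pm+\delta_\pm>0$, and $c>0$, and suppose these parameters are such that $0$ is a two-fold eigenvalue (two-dimensional eigenspace) of the type-I interface Hamiltonian $\hat H_{\mathrm I}(0)$ defined in the context. Then there is a positive real constant $E^{(1)}_{\mathrm I}$, determined by $(b_\pm,\delta_\pm,c)$, such that for all sufficiently small $k\neq 0$ the operator $\hat H_{\mathrm I}(k)$ has two distinct eigenvalues $E_{\mathrm I,+}(k)$, $E_{\mathrm I,-}(k)$ near $0$ satisfying $$E_{\mathrm I,\pm}(k)=\pm E^{(1)}_{\mathrm I}|k|+\mathcal O(k^2).$$
   Context: Coefficients: for $n\in\mathbb Z$ let $b_n=b_+$ for $n\ge0$ and $b_n=b_-$ for $n\le -1$; $c_n=b_++\delta_+$ for $n\ge 0$, $c_{-1}=c$, $c_n=b_-+\delta_-$ for $n\le-2$; $d_n=b_++\delta_+$ for $n\ge0$, $d_n=b_-+\delta_-$ for $n\le -1$. For $k\in[-\pi,\pi)$, $\hat H_{\mathrm I}(k)$ is the bounded self-adjoint operator on $\ell^2(\mathbb Z;\mathbb C^6)$ acting on $u=\{(u_{j,n})_{j=1}^6\}_{n\in\mathbb Z}$ by $(\hat H_{\mathrm I}(k)u)_{1,n}=-b_nu_{4,n}-b_nu_{5,n}-c_{n-1}e^{-ik}u_{6,n-1}$, $(\hat H_{\mathrm I}(k)u)_{2,n}=-b_nu_{4,n}-d_ne^{ik}u_{5,n}-b_nu_{6,n}$, $(\hat H_{\mathrm I}(k)u)_{3,n}=-c_nu_{4,n+1}-b_nu_{5,n}-b_nu_{6,n}$,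 $(\hat H_{\mathrm I}(k)u)_{4,n}=-b_nu_{1,n}-b_nu_{2,n}-c_{n-1}u_{3,n-1}$, $(\hat H_{\mathrm I}(k)u)_{5,n}=-b_nu_{1,n}-d_ne^{-ik}u_{2,n}-b_nu_{3,n}$, $(\hat H_{\mathrm I}(k)u)_{6,n}=-c_ne^{ik}u_{1,n+1}-b_nu_{2,n}-b_nu_{3,n}$. *)

theory Defs
  imports "HOL-Analysis.Analysis" "HOL-Library.Function_Algebras"
begin

definition bcoef :: "real \<Rightarrow> real \<Rightarrow> int \<Rightarrow> complex" where
  "bcoef bp bm n = (if n \<ge> 0 then of_real bp else of_real bm)"

definition ccoef :: "real \<Rightarrow> real \<Rightarrow> real \<Rightarrow> real \<Rightarrow> real \<Rightarrow> int \<Rightarrow> complex" where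
  "ccoef bp bm dp dm c n =
     (if n \<ge> 0 then of_real (bp + dp) else if n = -1 then of_real c else of_real (bm + dm))"

definition dcoef :: "real \<Rightarrow> real \<Rightarrow> real \<Rightarrow> real \<Rightarrow> int \<Rightarrow> complex" where
  "dcoef bp bm dp dm n = (if n \<ge> 0 then of_real (bp + dp) else of_real (bm + dm))"

text \<open>Sequences u : Z -> C^6 are modelled as functions int => nat => complex, where the
  component index j ranges over {1..6}; components outside {1..6} are required to vanish.\<close>

definition l2seq :: "(int \<Rightarrow> nat \<Rightarrow> complex) \<Rightarrow> bool" where
  "l2seq u \<longleftrightarrow> (\<forall>n j. j \<notin> {1..6} \<longrightarrow> u n j = 0) \<and>
     (\<lambda>n. \<Sum>j\<in>{1..6}. (cmod (u n j))\<^sup>2) summable_on UNIV"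

definition HI :: "real \<Rightarrow> real \<Rightarrow> real \<Rightarrow> real \<Rightarrow> real \<Rightarrow> real
                 \<Rightarrow> (int \<Rightarrow> nat \<Rightarrow> complex) \<Rightarrow> (int \<Rightarrow> nat \<Rightarrow> complex)" where
  "HI bp bm dp dm c k u = (\<lambda>n j.
     let b = bcoef bp bm; cc = ccoef bp bm dp dm c; d = dcoef bp bm dp dm;
         e = cis k; e' = cis (-k) in
     if j = 1 then - b n * u n 4 - b n * u n 5 - cc (n-1) * e' * u (n-1) 6
     else if j = 2 then - b n * u n 4 - d n * e * u n 5 - b n * u n 6
     else if j = 3 then - cc n * u (n+1) 4 - b n * u n 5 - b n * u n 6
     else if j = 4 then - b n * u n 1 - b n * u n 2 - cc (n-1) * u (n-1) 3
     else if j = 5 then - b n * u n 1 - d n * e' * u n 2 - b n * u n 3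
     else if j = 6 then - cc n * e * u (n+1) 1 - b n * u n 2 - b n * u n 3
     else 0)"

definition sscale :: "complex \<Rightarrow> (int \<Rightarrow> nat \<Rightarrow> complex) \<Rightarrow> (int \<Rightarrow> nat \<Rightarrow> complex)" where
  "sscale a u = (\<lambda>n j. a * u n j)"

definition eigsp :: "real \<Rightarrow> real \<Rightarrow> real \<Rightarrow> real \<Rightarrow> real \<Rightarrow> real \<Rightarrow> complex
                     \<Rightarrow> (int \<Rightarrow> nat \<Rightarrow> complex) set" where
  "eigsp bp bm dp dm c k E = {u. l2seq u \<and> HI bp bm dp dm c k u = sscale E u}"

definition is_eigenvalue :: "real \<Rightarrow> real \<Rightarrow> real \<Rightarrow> real \<Rightarrow> real \<Rightarrow> real \<Rightarrow> complex \<Rightarrow> bool" where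
  "is_eigenvalue bp bm dp dm c k E \<longleftrightarrow> (\<exists>u\<in>eigsp bp bm dp dm c k E. u \<noteq> 0)"

end

theory Submission
  imports Defs
begin

text \<open>
  In the splitting of the six components into \<open>(1, 2, 3)\<close> and \<open>(4, 5, 6)\<close> the Hamiltonian is off-diagonal
  with blocks \<open>A(k)\<close> and its adjoint. Listing the three components of all cells in one row,
  \<open>m = 3 n + j\<close>, makes \<open>- A(0)\<close> a real Jacobi (tridiagonal) operator \<open>J\<close>, and the gauge
  \<open>exp (- i k n / 2)\<close> makes \<open>- A(k)\<close> a complex symmetric perturbation \<open>J + P(k)\<close> of it. Because of the
  symmetry it suffices to solve the antilinear problem \<open>(J + P(k)) f = E (cnj f)\<close>: then \<open>- (cnj f)\<close> and \<open>f\<close>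
  form an eigenvector for \<open>E\<close>, and \<open>cnj f\<close> and \<open>f\<close> one for \<open>- E\<close>.

  A zero mode of the Hamiltonian at \<open>k = 0\<close> yields a decaying real solution \<open>\<phi>\<close> of \<open>J \<phi> = 0\<close>. In the bulk
  the transfer matrix over a cell has determinant one and trace at least two, and decay forces it to
  be hyperbolic, so \<open>\<phi>\<close> and a second solution \<open>\<psi>\<close> with Wronskian one give an inverse of \<open>J\<close> on the
  orthogonal complement of \<open>\<phi>\<close> that is bounded in an exponentially weighted supremum norm.
  Lyapunov--Schmidt reduction by the contraction principle produces \<open>f\<close> near \<open>\<phi>\<close> with
  \<open>(J + P(k)) f = \<epsilon> (cnj f)\<close>, where \<open>\<epsilon> = i k S / |\<phi>|\<^sup>2 + O(k\<^sup>2)\<close>; rotating the phase of \<open>f\<close> replaces \<open>\<epsilon>\<close> by its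
  modulus. Summation by parts turns \<open>S\<close> into half the sum of \<open>q m (\<phi> m)\<^sup>2\<close>, with \<open>q\<close> the positive diagonal of
  \<open>J\<close>, so \<open>S > 0\<close>.
\<close>

section \<open>Exponentially weighted sequences\<close>

text \<open>A weighted supremum norm bound, stated as a predicate in the bound \<open>M\<close>. A
  rate above one describes controlled growth, as in \<open>psum_bound\<close>.\<close>

definition expbd :: "real \<Rightarrow> real \<Rightarrow> (int \<Rightarrow> complex) \<Rightarrow> bool" where
  "expbd r M f \<longleftrightarrow> (\<forall>m. cmod (f m) \<le> M * r ^ nat \<bar>m\<bar>)"

lemma expbdD: "expbd r M f \<Longrightarrow> cmod (f m) \<le> M * r ^ nat \<bar>m\<bar>"
  by (simp add: expbd_def)

lemma expbd_nonneg:
  assumes "expbd r M f"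
  shows "0 \<le> M"
  using expbdD[OF assms, of 0] by (simp add: order_trans[OF norm_ge_zero])

lemma expbd_mono:
  assumes "expbd r M f" "M \<le> M'" "0 \<le> r"
  shows "expbd r M' f"
  unfolding expbd_def
proof
  fix m
  have "M * r ^ nat \<bar>m\<bar> \<le> M' * r ^ nat \<bar>m\<bar>"
    using assms by (intro mult_right_mono) auto
  then show "cmod (f m) \<le> M' * r ^ nat \<bar>m\<bar>"
    using expbdD[OF assms(1), of m] by linarith
qed

lemma expbd_mono_rate:
  assumes "expbd r M f" "r \<le> r'" "0 \<le> r"
  shows "expbd r' M f"
  unfolding expbd_def
proof
  fix m
  have "M * r ^ nat \<bar>m\<bar> \<le> M * r' ^ nat \<bar>m\<bar>"
    using assms expbd_nonneg[OF assms(1)] by (intro mult_left_mono power_mono) auto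
  then show "cmod (f m) \<le> M * r' ^ nat \<bar>m\<bar>"
    using expbdD[OF assms(1), of m] by linarith
qed

lemma expbd_add:
  assumes "expbd r M f" "expbd r N g"
  shows "expbd r (M + N) (\<lambda>m. f m + g m)"
  unfolding expbd_def
proof
  fix m
  show "cmod (f m + g m) \<le> (M + N) * r ^ nat \<bar>m\<bar>"
    using norm_triangle_ineq[of "f m" "g m"] expbdD[OF assms(1), of m] expbdD[OF assms(2), of m]
    by (simp add: distrib_right)
qed

lemma expbd_diff:
  assumes "expbd r M f" "expbd r N g"
  shows "expbd r (M + N) (\<lambda>m. f m - g m)"
  unfolding expbd_def
proof
  fix m
  show "cmod (f m - g m) \<le> (M + N) * r ^ nat \<bar>m\<bar>"
    using norm_triangle_ineq4[of "f m" "g m"] expbdD[OF assms(1), of m] expbdD[OF assms(2), of m]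
    by (simp add: distrib_right)
qed

lemma expbd_cmult:
  assumes "expbd r M f" "cmod a \<le> A"
  shows "expbd r (A * M) (\<lambda>m. a * f m)"
  unfolding expbd_def
proof
  fix m
  have "cmod a * cmod (f m) \<le> A * (M * r ^ nat \<bar>m\<bar>)"
    using expbdD[OF assms(1), of m] assms(2)
    by (intro mult_mono) (auto intro: order_trans[OF norm_ge_zero])
  then show "cmod (a * f m) \<le> A * M * r ^ nat \<bar>m\<bar>"
    by (simp add: norm_mult mult.assoc)
qed

lemma expbd_cnj: "expbd r M f \<Longrightarrow> expbd r M (\<lambda>m. cnj (f m))"
  by (simp add: expbd_def)

lemma expbd_mult:
  assumes "expbd r M f" "expbd s N g"
  shows "expbd (r * s) (M * N) (\<lambda>m. f m * g m)"
  unfolding expbd_def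
proof
  fix m
  have "cmod (f m) * cmod (g m) \<le> (M * r ^ nat \<bar>m\<bar>) * (N * s ^ nat \<bar>m\<bar>)"
    using expbdD[OF assms(1), of m] expbdD[OF assms(2), of m]
    by (intro mult_mono) (auto intro: order_trans[OF norm_ge_zero])
  then show "cmod (f m * g m) \<le> (M * N) * (r * s) ^ nat \<bar>m\<bar>"
    by (simp add: norm_mult power_mult_distrib mult_ac)
qed

lemma expbd_shift:
  assumes "expbd r M f" "0 < r" "r < 1" "\<bar>i\<bar> \<le> 1"
  shows "expbd r (M / r) (\<lambda>m. f (m + i))"
  unfolding expbd_def
proof
  fix m :: int
  have "nat \<bar>m\<bar> \<le> Suc (nat \<bar>m + i\<bar>)" using assms(4) by linarith
  then have "r ^ Suc (nat \<bar>m + i\<bar>) \<le> r ^ nat \<bar>m\<bar>"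
    using assms(2,3) by (intro power_decreasing) auto
  then have "r ^ nat \<bar>m + i\<bar> \<le> r ^ nat \<bar>m\<bar> / r"
    using assms(2) by (simp add: field_simps)
  then have "M * r ^ nat \<bar>m + i\<bar> \<le> M * (r ^ nat \<bar>m\<bar> / r)"
    using expbd_nonneg[OF assms(1)] by (rule mult_left_mono)
  then show "cmod (f (m + i)) \<le> M / r * r ^ nat \<bar>m\<bar>"
    using expbdD[OF assms(1), of "m + i"] by simp
qed

text \<open>The library instance of \<^class>\<open>complete_space\<close> for bounded continuous functions asks for a
  metric domain, and \<^typ>\<open>int\<close> carries only a topology.\<close>

lemma complete_UNIV_bcontfun_int: "complete (UNIV :: (int \<Rightarrow>\<^sub>C complex) set)"
proof (rule completeI)
  fix f :: "nat \<Rightarrow> (int \<Rightarrow>\<^sub>C complex)"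
  assume c: "Cauchy f"
  have "\<exists>N. \<forall>m n x. N \<le> m \<and> N \<le> n \<and> True \<longrightarrow> dist (f m x) (f n x) < e" if "e > 0" for e
  proof -
    obtain N where "\<forall>m\<ge>N. \<forall>n\<ge>N. dist (f m) (f n) < e" using c \<open>e > 0\<close> unfolding Cauchy_def by auto
    then show ?thesis by (intro exI[of _ N]) (auto intro: dist_fun_lt_imp_dist_val_lt)
  qed
  then have "\<exists>l. \<forall>e>0. \<exists>N. \<forall>n x. N \<le> n \<and> True \<longrightarrow> dist (f n x) (l x) < e"
    by (subst uniformly_convergent_eq_cauchy) blast
  then obtain g where "uniform_limit UNIV f g sequentially"
    unfolding uniform_limit_sequentially_iff by auto
  from uniform_limit_bcontfunE[OF this sequentially_bot]
  show "\<exists>l\<in>UNIV. f \<longlonglongrightarrow> l" by (metis UNIV_I)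
qed

text \<open>Dividing by the weight turns the weighted ball into a closed ball of bounded functions,
  where Banach's theorem applies. Since \<open>expbd\<close> only bounds a difference, the Lipschitz
  hypothesis speaks of every bound \<open>D\<close> of it.\<close>

lemma expbd_contraction_fixpoint:
  fixes F :: "(int \<Rightarrow> complex) \<Rightarrow> int \<Rightarrow> complex"
  assumes r: "0 < r" and R: "0 \<le> R" and q: "0 \<le> q" "q < 1"
    and self: "\<And>f. expbd r R f \<Longrightarrow> expbd r R (F f)"
    and lip: "\<And>f g D. expbd r R f \<Longrightarrow> expbd r R g \<Longrightarrow> expbd r D (\<lambda>m. f m - g m)
                \<Longrightarrow> expbd r (q * D) (\<lambda>m. F f m - F g m)"
  shows "\<exists>f. expbd r R f \<and> F f = f"
proof -
  \<comment> \<open>\<open>W\<close> restores the weight and \<open>V\<close> removes it;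
    \<open>F\<close> is transported to a self-map of the ball by applying \<open>W\<close>, then
    \<open>F\<close>, then \<open>V\<close>.\<close>
  define W :: "(int \<Rightarrow>\<^sub>C complex) \<Rightarrow> int \<Rightarrow> complex" where
    "W = (\<lambda>g m. of_real (r ^ nat \<bar>m\<bar>) * apply_bcontfun g m)"
  define V :: "(int \<Rightarrow> complex) \<Rightarrow> (int \<Rightarrow>\<^sub>C complex)" where
    "V = (\<lambda>f. Bcontfun (\<lambda>m. f m / of_real (r ^ nat \<bar>m\<bar>)))"
  have V: "apply_bcontfun (V f) m = f m / of_real (r ^ nat \<bar>m\<bar>)" if "expbd r M f" for f M m
  proof -
    have "(\<lambda>m. f m / of_real (r ^ nat \<bar>m\<bar>)) \<in> bcontfun"
    proof (rule bcontfun_normI)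
      show "cmod (f m / of_real (r ^ nat \<bar>m\<bar>)) \<le> M" for m
        using expbdD[OF that, of m] r by (simp add: norm_divide norm_power divide_le_eq)
    qed simp
    then show ?thesis by (simp add: V_def Bcontfun_inverse)
  qed
  have W: "expbd r R (W g)" if "g \<in> cball 0 R" for g
    unfolding expbd_def
  proof
    fix m
    have "cmod (apply_bcontfun g m) \<le> R"
      using norm_bounded[of g m] that by (simp add: dist_norm)
    then show "cmod (W g m) \<le> R * r ^ nat \<bar>m\<bar>"
      using r by (simp add: W_def norm_mult norm_power mult.commute mult_left_mono)
  qed
  have "\<exists>!g\<in>cball 0 R. V (F (W g)) = g"
  proof (rule Banach_fix[OF _ _ q])
    show "complete (cball (0 :: int \<Rightarrow>\<^sub>C complex) R)"
      by (rule complete_closed_subset[OF _ subset_UNIV complete_UNIV_bcontfun_int]) simp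
    show "cball (0 :: int \<Rightarrow>\<^sub>C complex) R \<noteq> {}" using R by simp
    show "(\<lambda>g. V (F (W g))) ` cball 0 R \<subseteq> cball 0 R"
    proof safe
      fix g :: "int \<Rightarrow>\<^sub>C complex" assume "g \<in> cball 0 R"
      note FW = self[OF W[OF this]]
      have "norm (V (F (W g))) \<le> R"
      proof (rule norm_bound)
        fix m show "cmod (apply_bcontfun (V (F (W g))) m) \<le> R"
          unfolding V[OF FW] using expbdD[OF FW, of m] r
          by (simp add: norm_divide norm_power divide_le_eq)
      qed
      then show "V (F (W g)) \<in> cball 0 R" by simp
    qed
    fix g h :: "int \<Rightarrow>\<^sub>C complex"
    assume gh: "g \<in> cball 0 R" "h \<in> cball 0 R"
    have "expbd r (dist g h) (\<lambda>m. W g m - W h m)"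
      unfolding expbd_def
    proof
      fix m
      have "cmod (apply_bcontfun g m - apply_bcontfun h m) \<le> dist g h"
        using dist_bounded[of g m h] by (simp add: dist_norm)
      then show "cmod (W g m - W h m) \<le> dist g h * r ^ nat \<bar>m\<bar>"
        unfolding W_def right_diff_distrib[symmetric] using r
        by (simp add: norm_mult norm_power mult.commute mult_left_mono)
    qed
    with gh have *: "expbd r (q * dist g h) (\<lambda>m. F (W g) m - F (W h) m)"
      by (intro lip W) auto
    show "dist (V (F (W g))) (V (F (W h))) \<le> q * dist g h"
    proof (rule dist_bound)
      fix m
      show "dist (apply_bcontfun (V (F (W g))) m) (apply_bcontfun (V (F (W h))) m) \<le> q * dist g h"
        using gh expbdD[OF *, of m] r
        by (simp add: V[OF self[OF W]] dist_norm diff_divide_distrib[symmetric] norm_divide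
            norm_power divide_le_eq)
    qed
  qed
  then obtain g where g: "g \<in> cball 0 R" "V (F (W g)) = g" by auto
  have "F (W g) m = W g m" for m
    using V[OF self[OF W[OF g(1)]], of m] r unfolding g(2) by (simp add: W_def)
  then show ?thesis using W[OF g(1)] by (intro exI[of _ "W g"]) auto
qed

section \<open>One-sided and two-sided sums of decaying sequences\<close>

definition lsum :: "(int \<Rightarrow> complex) \<Rightarrow> int \<Rightarrow> complex" where
  "lsum h m = (\<Sum>i. h (m - int i))"

definition rsum :: "(int \<Rightarrow> complex) \<Rightarrow> int \<Rightarrow> complex" where
  "rsum h m = (\<Sum>i. h (m + int i))"

text \<open>The cut between \<open>-1\<close> and \<open>0\<close> is a convention;
  \<open>zsum_split\<close> moves it to any place.\<close>

definition zsum :: "(int \<Rightarrow> complex) \<Rightarrow> complex" where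
  "zsum h = lsum h (-1) + rsum h 0"

lemma expbd_summable_norm:
  assumes "expbd \<rho> M h" "0 < \<rho>" "\<rho> < 1"
  shows "summable (\<lambda>i. norm (h (m - int i)))" "summable (\<lambda>i. norm (h (m + int i)))"
proof -
  \<comment> \<open>Comparison with a geometric series centred at \<open>m\<close> costs the factor
    \<open>1 / \<rho> ^ nat |m|\<close>, because \<open>i \<le> |l| + |m|\<close>.\<close>
  have b: "cmod (h l) \<le> (M / \<rho> ^ nat \<bar>m\<bar>) * \<rho> ^ i" if "\<bar>l - m\<bar> = int i" for l i
  proof -
    have "i \<le> nat \<bar>l\<bar> + nat \<bar>m\<bar>" using that by linarith
    then have "\<rho> ^ (nat \<bar>l\<bar> + nat \<bar>m\<bar>) \<le> \<rho> ^ i"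
      using assms(2,3) by (intro power_decreasing) auto
    then have "M * (\<rho> ^ nat \<bar>l\<bar> * \<rho> ^ nat \<bar>m\<bar>) \<le> M * \<rho> ^ i"
      using expbd_nonneg[OF assms(1)] by (simp add: power_add mult_left_mono)
    then have "M * \<rho> ^ nat \<bar>l\<bar> \<le> (M / \<rho> ^ nat \<bar>m\<bar>) * \<rho> ^ i"
      using assms(2) by (simp add: field_simps)
    then show ?thesis using expbdD[OF assms(1), of l] by linarith
  qed
  have s: "summable (\<lambda>i. (M / \<rho> ^ nat \<bar>m\<bar>) * \<rho> ^ i)"
    using assms by (intro summable_mult summable_geometric) auto
  show "summable (\<lambda>i. norm (h (m - int i)))"
    by (rule summable_comparison_test'[OF s, of 0]) (subst real_norm_def, subst abs_norm_cancel, rule b, simp)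
  show "summable (\<lambda>i. norm (h (m + int i)))"
    by (rule summable_comparison_test'[OF s, of 0]) (subst real_norm_def, subst abs_norm_cancel, rule b, simp)
qed

lemmas expbd_summable = expbd_summable_norm[THEN summable_norm_cancel]

lemma norm_suminf_geometric_le:
  fixes g :: "nat \<Rightarrow> complex"
  assumes "\<And>i. cmod (g i) \<le> A * \<rho> ^ i" "0 < \<rho>" "\<rho> < 1"
  shows "cmod (\<Sum>i. g i) \<le> A / (1 - \<rho>)"
proof -
  have s: "(\<lambda>i. A * \<rho> ^ i) sums (A * (1 / (1 - \<rho>)))"
    using assms by (intro sums_mult geometric_sums) auto
  have "cmod (\<Sum>i. g i) \<le> (\<Sum>i. A * \<rho> ^ i)"
    using s assms(1) by (intro norm_suminf_le) (auto simp: sums_iff)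
  then show ?thesis using s by (simp add: sums_iff)
qed

text \<open>With \<open>m \<le> 0\<close> the summation runs away from the origin, so a geometric
  series starting at the bound for \<open>h m\<close> majorizes it; \<open>rsum_bound\<close> is the
  mirror image.\<close>

lemma lsum_bound:
  assumes "expbd \<rho> M h" "0 < \<rho>" "\<rho> < 1" "m \<le> 0"
  shows "cmod (lsum h m) \<le> M / (1 - \<rho>) * \<rho> ^ nat \<bar>m\<bar>"
proof -
  have "cmod (lsum h m) \<le> (M * \<rho> ^ nat \<bar>m\<bar>) / (1 - \<rho>)"
    unfolding lsum_def
  proof (rule norm_suminf_geometric_le[OF _ assms(2,3)])
    fix i
    have "nat \<bar>m - int i\<bar> = nat \<bar>m\<bar> + i" using assms(4) by linarith
    then show "cmod (h (m - int i)) \<le> M * \<rho> ^ nat \<bar>m\<bar> * \<rho> ^ i"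
      using expbdD[OF assms(1), of "m - int i"] by (simp add: power_add mult_ac)
  qed
  then show ?thesis by (simp add: field_simps)
qed

lemma rsum_bound:
  assumes "expbd \<rho> M h" "0 < \<rho>" "\<rho> < 1" "m \<ge> 0"
  shows "cmod (rsum h m) \<le> M / (1 - \<rho>) * \<rho> ^ nat \<bar>m\<bar>"
proof -
  have "cmod (rsum h m) \<le> (M * \<rho> ^ nat \<bar>m\<bar>) / (1 - \<rho>)"
    unfolding rsum_def
  proof (rule norm_suminf_geometric_le[OF _ assms(2,3)])
    fix i
    have "nat \<bar>m + int i\<bar> = nat \<bar>m\<bar> + i" using assms(4) by linarith
    then show "cmod (h (m + int i)) \<le> M * \<rho> ^ nat \<bar>m\<bar> * \<rho> ^ i"
      using expbdD[OF assms(1), of "m + int i"] by (simp add: power_add mult_ac)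
  qed
  then show ?thesis by (simp add: field_simps)
qed

lemma zsum_bound:
  assumes "expbd \<rho> M h" "0 < \<rho>" "\<rho> < 1"
  shows "cmod (zsum h) \<le> 2 / (1 - \<rho>) * M"
proof -
  have "M / (1 - \<rho>) * \<rho> \<le> M / (1 - \<rho>) * 1"
    using assms(2,3) expbd_nonneg[OF assms(1)] by (intro mult_left_mono) auto
  then show ?thesis
    using lsum_bound[OF assms, of "-1"] rsum_bound[OF assms, of 0]
      norm_triangle_ineq[of "lsum h (-1)" "rsum h 0"]
    by (simp add: zsum_def)
qed

lemma lsum_rec:
  assumes "expbd \<rho> M h" "0 < \<rho>" "\<rho> < 1"
  shows "lsum h m = h m + lsum h (m - 1)"
  using suminf_split_head[OF expbd_summable(1)[OF assms, of m]]
  by (simp add: lsum_def algebra_simps)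

lemma rsum_rec:
  assumes "expbd \<rho> M h" "0 < \<rho>" "\<rho> < 1"
  shows "rsum h m = h m + rsum h (m + 1)"
  using suminf_split_head[OF expbd_summable(2)[OF assms, of m]]
  by (simp add: rsum_def algebra_simps)

lemma zsum_split:
  assumes "expbd \<rho> M h" "0 < \<rho>" "\<rho> < 1"
  shows "zsum h = lsum h m + rsum h (m + 1)"
proof (induction m rule: int_induct[where k = "-1"])
  case base
  then show ?case by (simp add: zsum_def)
next
  case (step1 i)
  then show ?case using lsum_rec[OF assms, of "i + 1"] rsum_rec[OF assms, of "i + 1"] by simp
next
  case (step2 i)
  then show ?case using lsum_rec[OF assms, of i] rsum_rec[OF assms, of i] by simp
qed

lemma lsum_diff:
  assumes "expbd \<rho> M h" "expbd \<rho> N g" "0 < \<rho>" "\<rho> < 1"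
  shows "lsum (\<lambda>m. h m - g m) n = lsum h n - lsum g n"
  unfolding lsum_def
  by (rule suminf_diff[symmetric]; rule expbd_summable[OF _ assms(3,4)], rule assms)

lemma rsum_diff:
  assumes "expbd \<rho> M h" "expbd \<rho> N g" "0 < \<rho>" "\<rho> < 1"
  shows "rsum (\<lambda>m. h m - g m) n = rsum h n - rsum g n"
  unfolding rsum_def
  by (rule suminf_diff[symmetric]; rule expbd_summable[OF _ assms(3,4)], rule assms)

lemma zsum_diff:
  assumes "expbd \<rho> M h" "expbd \<rho> N g" "0 < \<rho>" "\<rho> < 1"
  shows "zsum (\<lambda>m. h m - g m) = zsum h - zsum g"
  by (simp add: zsum_def lsum_diff[OF assms] rsum_diff[OF assms])

lemma zsum_add:
  assumes "expbd \<rho> M h" "expbd \<rho> N g" "0 < \<rho>" "\<rho> < 1"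
  shows "zsum (\<lambda>m. h m + g m) = zsum h + zsum g"
  using zsum_diff[OF expbd_add[OF assms(1,2)] assms(2-4)] by simp

lemma zsum_cmult:
  assumes "expbd \<rho> M h" "0 < \<rho>" "\<rho> < 1"
  shows "zsum (\<lambda>m. a * h m) = a * zsum h"
  by (simp add: zsum_def lsum_def rsum_def distrib_left suminf_mult[OF expbd_summable(1)[OF assms]]
      suminf_mult[OF expbd_summable(2)[OF assms, of 0], simplified])

lemma zsum_cnj:
  assumes "expbd \<rho> M h" "0 < \<rho>" "\<rho> < 1"
  shows "zsum (\<lambda>m. cnj (h m)) = cnj (zsum h)"
  by (simp add: zsum_def lsum_def rsum_def bounded_linear.suminf[OF bounded_linear_cnj expbd_summable(1)[OF assms]]
      bounded_linear.suminf[OF bounded_linear_cnj expbd_summable(2)[OF assms, of 0], simplified])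

lemma zsum_telescope:
  assumes "expbd \<rho> M s" "0 < \<rho>" "\<rho> < 1"
  shows "zsum (\<lambda>m. s m - s (m - 1)) = 0"
proof -
  have sh: "expbd \<rho> (M / \<rho>) (\<lambda>m. s (m - 1))"
    using expbd_shift[OF assms, of "-1"] by simp
  have sc: "expbd \<rho> (M / \<rho>) s"
    using assms expbd_nonneg[OF assms(1)]
    by (intro expbd_mono[OF assms(1)]) (auto simp: le_divide_eq mult_left_le)
  \<comment> \<open>The shifted sum cut between \<open>-1\<close> and \<open>0\<close> agrees term
    by term with the original sum cut between \<open>-2\<close> and \<open>-1\<close>.\<close>
  have "zsum (\<lambda>m. s (m - 1)) = zsum s"
  proof -
    have "- 1 - int i - 1 = - 2 - int i" "0 + int i - 1 = - 2 + 1 + int i" for i by simp_all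
    then show ?thesis
      unfolding zsum_split[OF assms, of "-2"]
      by (simp only: zsum_def[of "\<lambda>m. s (m - 1)"] lsum_def rsum_def)
  qed
  then show ?thesis using zsum_diff[OF sc sh assms(2,3)] by simp
qed

lemma zsum_of_real_pos:
  assumes "expbd \<rho> M (\<lambda>m. of_real (h m))" "0 < \<rho>" "\<rho> < 1" "\<And>m. h m \<ge> 0" "h l > 0"
  shows "\<exists>x > 0. zsum (\<lambda>m. of_real (h m)) = of_real x"
proof -
  note sum = expbd_summable[OF assms(1-3)]
  have sl: "summable (\<lambda>i. h (m - int i))" for m using sum(1)[of m] by (simp only: summable_of_real_iff)
  have sr: "summable (\<lambda>i. h (m + int i))" for m using sum(2)[of m] by (simp only: summable_of_real_iff)
  \<comment> \<open>Cutting at \<open>l\<close> makes the positive term the head of the left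
    sum.\<close>
  have eq: "zsum (\<lambda>m. of_real (h m)) = of_real ((\<Sum>i. h (l - int i)) + (\<Sum>i. h (l + 1 + int i)))"
    unfolding zsum_split[OF assms(1-3), of l] lsum_def rsum_def
    using suminf_of_real[OF sl, of l, where 'a = complex] suminf_of_real[OF sr, of "l + 1", where 'a = complex]
    by simp
  have "0 < (\<Sum>i. h (l - int i))"
    using suminf_pos2[OF sl, of l 0] assms(4,5) by simp
  moreover have "0 \<le> (\<Sum>i. h (l + 1 + int i))"
    using suminf_nonneg[OF sr, of "l + 1"] assms(4) by simp
  ultimately show ?thesis using eq by (meson add_pos_nonneg)
qed

text \<open>The discrete antiderivative of \<open>h\<close> that vanishes at \<open>0\<close>. It is
  a signed finite sum, so \<open>psum_rec\<close> holds on all integers and \<open>h\<close> may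
  grow.\<close>

definition psum :: "(int \<Rightarrow> complex) \<Rightarrow> int \<Rightarrow> complex" where
  "psum h m = (\<Sum>i<nat m. h (int i + 1)) - (\<Sum>i<nat (- m). h (- int i))"

lemma psum_rec: "psum h m = h m + psum h (m - 1)"
proof (cases "m > 0")
  case True
  then have "nat m = Suc (nat (m - 1))" by linarith
  then show ?thesis using True by (simp add: psum_def)
next
  case False
  then have "nat (- (m - 1)) = Suc (nat (- m))" by linarith
  then show ?thesis using False by (simp add: psum_def)
qed

lemma psum_diff: "psum (\<lambda>m. h m - g m) n = psum h n - psum g n"
  by (simp add: psum_def sum_subtractf)

lemma psum_bound:
  assumes "expbd s M h" "1 < s"
  shows "expbd s (M * s / (s - 1)) (psum h)"
  unfolding expbd_def
proof
  fix m
  define K where "K = M * s / (s - 1)"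
  have M: "0 \<le> M" by (rule expbd_nonneg[OF assms(1)])
  \<comment> \<open>\<open>K\<close> is the fixed point of the one-step estimate, so the induction
    closes in both directions with the same constant.\<close>
  have K: "K * s = K + M * s" using assms(2) by (simp add: K_def field_simps)
  have K0: "K \<ge> 0" using M assms(2) by (simp add: K_def)
  have "cmod (psum h m) \<le> K * s ^ nat \<bar>m\<bar>"
  proof (induction m rule: int_induct[where k = 0])
    case base
    then show ?case using K0 by (simp add: psum_def)
  next
    case (step1 i)
    then have n: "nat \<bar>i + 1\<bar> = Suc (nat \<bar>i\<bar>)" by linarith
    have "cmod (psum h (i + 1)) \<le> M * s ^ nat \<bar>i + 1\<bar> + K * s ^ nat \<bar>i\<bar>"
      using psum_rec[of h "i + 1"] norm_triangle_ineq[of "h (i + 1)" "psum h i"]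
        expbdD[OF assms(1), of "i + 1"] step1 by simp
    also have "\<dots> = (K + M * s) * s ^ nat \<bar>i\<bar>" unfolding n by (simp add: algebra_simps)
    also have "\<dots> = K * s ^ nat \<bar>i + 1\<bar>" by (simp add: n K[symmetric])
    finally show ?case .
  next
    case (step2 i)
    then have n: "nat \<bar>i - 1\<bar> = Suc (nat \<bar>i\<bar>)" by linarith
    have "cmod (psum h (i - 1)) \<le> M * s ^ nat \<bar>i\<bar> + K * s ^ nat \<bar>i\<bar>"
      using psum_rec[of h i] norm_triangle_ineq4[of "psum h i" "h i"]
        expbdD[OF assms(1), of i] step2 by simp
    also have "\<dots> \<le> M * s * s ^ nat \<bar>i\<bar> + K * s ^ nat \<bar>i\<bar>"
      using mult_left_mono[of 1 s M] M assms(2) by (intro add_mono mult_right_mono) auto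
    also have "\<dots> = (K + M * s) * s ^ nat \<bar>i\<bar>" by (simp add: algebra_simps)
    also have "\<dots> = K * s ^ nat \<bar>i - 1\<bar>" by (simp add: n K[symmetric])
    finally show ?case .
  qed
  then show "cmod (psum h m) \<le> M * s / (s - 1) * s ^ nat \<bar>m\<bar>" by (simp add: K_def)
qed

section \<open>Green operator at a zero mode\<close>

definition jac :: "(int \<Rightarrow> real) \<Rightarrow> (int \<Rightarrow> real) \<Rightarrow> (int \<Rightarrow> complex) \<Rightarrow> int \<Rightarrow> complex" where
  "jac p q f m = of_real (p (m - 1)) * f (m - 1) + of_real (q m) * f m + of_real (p m) * f (m + 1)"

text \<open>\<open>a\<close> decays at the rate at which \<open>b\<close> may grow. The tail sums of
  \<open>a * f\<close> are of order \<open>(l * r) ^ |m|\<close> and the partial sums of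
  \<open>b * f\<close> of order \<open>(r / l) ^ |m|\<close>, where \<open>l < r\<close> enters;
  multiplied by \<open>b\<close> and \<open>a\<close> respectively, both return to order
  \<open>r ^ |m|\<close>.\<close>

lemma variation_of_constants_bounds:
  assumes a: "expbd l C a" and b: "expbd (1 / l) C b" and f: "expbd r M f"
    and l: "0 < l" "l < r" "r < 1"
  shows "m \<ge> 0 \<Longrightarrow> cmod (b m * rsum (\<lambda>j. a j * f j) (m + 1)) \<le> C * (C / (1 - l * r)) * M * r ^ nat \<bar>m\<bar>"
    and "m \<le> 0 \<Longrightarrow> cmod (b m * lsum (\<lambda>j. a j * f j) m) \<le> C * (C / (1 - l * r)) * M * r ^ nat \<bar>m\<bar>"
    and "cmod (a m * psum (\<lambda>j. b j * f j) m) \<le> C * (C * (r / l) / (r / l - 1)) * M * r ^ nat \<bar>m\<bar>"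
proof -
  have "l * r < 1 * 1" using l by (intro mult_strict_mono) auto
  then have lr: "0 < l * r" "l * r < 1" using l by simp_all
  note h = expbd_mult[OF a f]
  have CM: "0 \<le> C" "0 \<le> M" using expbd_nonneg[OF a] expbd_nonneg[OF f] by auto
  have cancel: "(1 / l) ^ n * (l * r) ^ n = r ^ n" for n
    using l by (simp add: power_mult_distrib power_one_over)
  have prod: "cmod (b m * x) \<le> C * (C / (1 - l * r)) * M * r ^ nat \<bar>m\<bar>"
    if "cmod x \<le> C * M / (1 - l * r) * (l * r) ^ nat \<bar>m\<bar>" for x
  proof -
    have "cmod (b m * x) \<le> (C * (1 / l) ^ nat \<bar>m\<bar>) * (C * M / (1 - l * r) * (l * r) ^ nat \<bar>m\<bar>)"
      unfolding norm_mult using expbdD[OF b, of m] that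
      by (intro mult_mono) (auto intro: order_trans[OF norm_ge_zero])
    also have "\<dots> = C * (C / (1 - l * r)) * M * ((1 / l) ^ nat \<bar>m\<bar> * (l * r) ^ nat \<bar>m\<bar>)"
      by (simp add: mult_ac)
    finally show ?thesis unfolding cancel .
  qed
  show "cmod (b m * rsum (\<lambda>j. a j * f j) (m + 1)) \<le> C * (C / (1 - l * r)) * M * r ^ nat \<bar>m\<bar>" if "m \<ge> 0"
  proof (rule prod)
    have "(l * r) ^ nat \<bar>m + 1\<bar> \<le> (l * r) ^ nat \<bar>m\<bar>"
      using lr that by (intro power_decreasing) auto
    then have "C * M / (1 - l * r) * (l * r) ^ nat \<bar>m + 1\<bar> \<le> C * M / (1 - l * r) * (l * r) ^ nat \<bar>m\<bar>"
      using lr CM by (intro mult_left_mono) auto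
    then show "cmod (rsum (\<lambda>j. a j * f j) (m + 1)) \<le> C * M / (1 - l * r) * (l * r) ^ nat \<bar>m\<bar>"
      using rsum_bound[OF h lr, of "m + 1"] that by linarith
  qed
  show "cmod (b m * lsum (\<lambda>j. a j * f j) m) \<le> C * (C / (1 - l * r)) * M * r ^ nat \<bar>m\<bar>" if "m \<le> 0"
    using lsum_bound[OF h lr that] by (rule prod)
  have s: "1 < r / l" using l by simp
  have bf: "expbd (r / l) (C * M) (\<lambda>j. b j * f j)" using expbd_mult[OF b f] by simp
  have e: "l * (r / l) = r" using l by simp
  have "expbd r (C * (C * M * (r / l) / (r / l - 1))) (\<lambda>m. a m * psum (\<lambda>j. b j * f j) m)"
    using expbd_mult[OF a psum_bound[OF bf s]] unfolding e .
  from expbdD[OF this, of m]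
  show "cmod (a m * psum (\<lambda>j. b j * f j) m) \<le> C * (C * (r / l) / (r / l - 1)) * M * r ^ nat \<bar>m\<bar>"
    by (simp add: mult_ac)
qed

text \<open>The two half-lines have different decay rates, and the growth of the second solution must match
  the decay of the zero mode on each side separately.\<close>

locale jacobi_zero_mode =
  fixes p q \<phi> \<psi> :: "int \<Rightarrow> real" and lp lm lam r C :: real
  assumes rates: "0 < lp" "0 < lm" "lp \<le> lam" "lm \<le> lam" "lam < r" "r < 1"
    and phi: "\<And>m. p (m - 1) * \<phi> (m - 1) + q m * \<phi> m + p m * \<phi> (m + 1) = 0"
    and psi: "\<And>m. p (m - 1) * \<psi> (m - 1) + q m * \<psi> m + p m * \<psi> (m + 1) = 0"
    and wronskian: "\<And>m. p m * (\<phi> m * \<psi> (m + 1) - \<phi> (m + 1) * \<psi> m) = 1"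
    and phi_bound_right: "\<And>m. m \<ge> 0 \<Longrightarrow> \<bar>\<phi> m\<bar> \<le> C * lp ^ nat \<bar>m\<bar>"
    and phi_bound_left: "\<And>m. m \<le> 0 \<Longrightarrow> \<bar>\<phi> m\<bar> \<le> C * lm ^ nat \<bar>m\<bar>"
    and psi_bound_right: "\<And>m. m \<ge> 0 \<Longrightarrow> \<bar>\<psi> m\<bar> \<le> C * (1 / lp) ^ nat \<bar>m\<bar>"
    and psi_bound_left: "\<And>m. m \<le> 0 \<Longrightarrow> \<bar>\<psi> m\<bar> \<le> C * (1 / lm) ^ nat \<bar>m\<bar>"
begin

abbreviation \<Phi> :: "int \<Rightarrow> complex" where "\<Phi> m \<equiv> of_real (\<phi> m)"
abbreviation \<Psi> :: "int \<Rightarrow> complex" where "\<Psi> m \<equiv> of_real (\<psi> m)"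

lemma lam_pos: "0 < lam" and r_pos: "0 < r" using rates by linarith+

lemma lam_r: "0 < lam * r" "lam * r < 1"
proof -
  show "0 < lam * r" using lam_pos r_pos by simp
  have "lam * r < 1 * 1" using rates lam_pos by (intro mult_strict_mono) auto
  then show "lam * r < 1" by simp
qed

lemma C_nonneg: "0 \<le> C" using phi_bound_right[of 0] by simp

lemma expbd_Phi_lam: "expbd lam C \<Phi>"
  unfolding expbd_def
proof
  fix m
  have "C * lp ^ nat \<bar>m\<bar> \<le> C * lam ^ nat \<bar>m\<bar>" "C * lm ^ nat \<bar>m\<bar> \<le> C * lam ^ nat \<bar>m\<bar>"
    using rates C_nonneg by (auto intro!: mult_left_mono power_mono)
  then show "cmod (\<Phi> m) \<le> C * lam ^ nat \<bar>m\<bar>"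
    using phi_bound_right[of m] phi_bound_left[of m] by (cases "m \<ge> 0") auto
qed

lemma expbd_Phi: "expbd r C \<Phi>"
  using expbd_mono_rate[OF expbd_Phi_lam] rates lam_pos by simp

lemma expbd_Phi_mult: "expbd r M f \<Longrightarrow> expbd (lam * r) (C * M) (\<lambda>m. \<Phi> m * f m)"
  by (rule expbd_mult[OF expbd_Phi_lam])

text \<open>The pairing with the zero mode; \<open>\<Phi>\<close> is real, so it needs no
  conjugate.\<close>

definition ip :: "(int \<Rightarrow> complex) \<Rightarrow> complex" where
  "ip f = zsum (\<lambda>m. \<Phi> m * f m)"

lemma ip_bound:
  assumes "expbd r M f"
  shows "cmod (ip f) \<le> 2 * C / (1 - lam * r) * M"
  using zsum_bound[OF expbd_Phi_mult[OF assms] lam_r] by (simp add: ip_def mult_ac)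

lemma ip_diff:
  assumes "expbd r M f" "expbd r N g"
  shows "ip (\<lambda>m. f m - g m) = ip f - ip g"
  using zsum_diff[OF expbd_Phi_mult[OF assms(1)] expbd_Phi_mult[OF assms(2)] lam_r]
  by (simp add: ip_def right_diff_distrib)

lemma ip_add:
  assumes "expbd r M f" "expbd r N g"
  shows "ip (\<lambda>m. f m + g m) = ip f + ip g"
  using zsum_add[OF expbd_Phi_mult[OF assms(1)] expbd_Phi_mult[OF assms(2)] lam_r]
  by (simp add: ip_def distrib_left)

lemma ip_cmult:
  assumes "expbd r M f"
  shows "ip (\<lambda>m. a * f m) = a * ip f"
  using zsum_cmult[OF expbd_Phi_mult[OF assms(1)] lam_r, of a]
  by (simp add: ip_def mult.left_commute)

lemma ip_cnj:
  assumes "expbd r M f"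
  shows "ip (\<lambda>m. cnj (f m)) = cnj (ip f)"
  using zsum_cnj[OF expbd_Phi_mult[OF assms(1)] lam_r] by (simp add: ip_def)

lemma phi_nonzero: "\<exists>m. \<phi> m \<noteq> 0"
proof (rule ccontr)
  assume "\<nexists>m. \<phi> m \<noteq> 0"
  then show False using wronskian[of 0] by simp
qed

text \<open>The squared l2 norm of the zero mode.\<close>

definition nrm :: real where "nrm = Re (ip \<Phi>)"

lemma ip_Phi: "ip \<Phi> = of_real nrm" and nrm_pos: "nrm > 0"
proof -
  obtain l where "\<phi> l \<noteq> 0" using phi_nonzero by blast
  then have "\<exists>x > 0. zsum (\<lambda>m. of_real (\<phi> m * \<phi> m)) = of_real x"
  proof (intro zsum_of_real_pos[of "lam * r" "C * C" _ l] lam_r)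
    show "expbd (lam * r) (C * C) (\<lambda>m. of_real (\<phi> m * \<phi> m))"
      using expbd_Phi_mult[OF expbd_Phi] by simp
    show "0 < \<phi> l * \<phi> l" using \<open>\<phi> l \<noteq> 0\<close> by (metis not_real_square_gt_zero)
  qed simp
  then obtain x where x: "x > 0" "ip \<Phi> = of_real x" by (auto simp: ip_def)
  then show "ip \<Phi> = of_real nrm" "nrm > 0" by (auto simp: nrm_def)
qed

text \<open>Variation of constants. The coefficient of \<open>\<Psi>\<close> is a sum taken towards
  infinity on either side, which gives decay for every decaying \<open>f\<close>; the two branches
  become one formula when \<open>ip f = 0\<close>.\<close>

definition green0 :: "(int \<Rightarrow> complex) \<Rightarrow> int \<Rightarrow> complex" where
  "green0 f m = (if m \<ge> 0 then - \<Psi> m * rsum (\<lambda>l. \<Phi> l * f l) (m + 1) else \<Psi> m * lsum (\<lambda>l. \<Phi> l * f l) m)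
     - \<Phi> m * psum (\<lambda>l. \<Psi> l * f l) m"

text \<open>The constants of \<open>variation_of_constants_bounds\<close> for the right and the left
  half-line, added instead of taking a maximum.\<close>

definition KG0 :: real where
  "KG0 = C * (C / (1 - lp * r)) + C * (C * (r / lp) / (r / lp - 1))
       + (C * (C / (1 - lm * r)) + C * (C * (r / lm) / (r / lm - 1)))"

lemma KG0_half_nonneg:
  assumes "0 < l" "l \<le> lam"
  shows "0 \<le> C * (C / (1 - l * r)) + C * (C * (r / l) / (r / l - 1))"
proof -
  have "l * r \<le> lam * r" "1 < r / l" using assms rates r_pos by (auto intro!: mult_right_mono)
  then have "l * r < 1" "1 < r / l" using lam_r by linarith+
  then show ?thesis using assms C_nonneg r_pos
    by (intro add_nonneg_nonneg mult_nonneg_nonneg divide_nonneg_nonneg) auto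
qed

lemma KG0_nonneg: "0 \<le> KG0"
  using KG0_half_nonneg[of lp] KG0_half_nonneg[of lm] rates by (simp add: KG0_def)

lemma green0_bound:
  assumes "expbd r M f"
  shows "expbd r (KG0 * M) (green0 f)"
  unfolding expbd_def
proof
  fix m
  have M: "0 \<le> M" by (rule expbd_nonneg[OF assms])
  define kp where "kp = C * (C / (1 - lp * r)) + C * (C * (r / lp) / (r / lp - 1))"
  define km where "km = C * (C / (1 - lm * r)) + C * (C * (r / lm) / (r / lm - 1))"
  have k: "KG0 = kp + km" "0 \<le> kp" "0 \<le> km"
    using KG0_half_nonneg[of lp] KG0_half_nonneg[of lm] rates by (simp_all add: KG0_def kp_def km_def)
  have "\<exists>k. (k = kp \<or> k = km) \<and> cmod (green0 f m) \<le> k * M * r ^ nat \<bar>m\<bar>"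
  proof (cases "m \<ge> 0")
    case True
    \<comment> \<open>Truncating \<open>\<Phi>\<close> and \<open>\<Psi>\<close> to the half-line of
      \<open>m\<close> leaves the sums in \<open>green0\<close> at \<open>m\<close> unchanged and
      makes a single rate valid everywhere.\<close>
    define a where "a = (\<lambda>l. if l \<ge> 0 then \<Phi> l else 0)"
    define b where "b = (\<lambda>l. if l \<ge> 0 then \<Psi> l else 0)"
    have "expbd lp C a" "expbd (1 / lp) C b"
      using phi_bound_right psi_bound_right C_nonneg rates by (auto simp: expbd_def a_def b_def)
    from variation_of_constants_bounds[OF this assms rates(1) _ rates(6), of m] rates True
    have "cmod (b m * rsum (\<lambda>j. a j * f j) (m + 1)) \<le> C * (C / (1 - lp * r)) * M * r ^ nat \<bar>m\<bar>"
      "cmod (a m * psum (\<lambda>j. b j * f j) m) \<le> C * (C * (r / lp) / (r / lp - 1)) * M * r ^ nat \<bar>m\<bar>"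
      by auto
    moreover have "rsum (\<lambda>j. a j * f j) (m + 1) = rsum (\<lambda>j. \<Phi> j * f j) (m + 1)"
      "psum (\<lambda>j. b j * f j) m = psum (\<lambda>j. \<Psi> j * f j) m"
      using True by (simp_all add: rsum_def psum_def a_def b_def)
    ultimately have "cmod (green0 f m) \<le> kp * M * r ^ nat \<bar>m\<bar>"
      using True norm_triangle_ineq4[of "- b m * rsum (\<lambda>j. a j * f j) (m + 1)" "a m * psum (\<lambda>j. b j * f j) m"]
      by (simp add: green0_def a_def b_def kp_def distrib_right)
    then show ?thesis by blast
  next
    case False
    \<comment> \<open>Index \<open>0\<close> belongs to this truncation too, since
      \<open>psum\<close> at a negative place starts from the term at \<open>0\<close>.\<close>
    define a where "a = (\<lambda>l. if l \<le> 0 then \<Phi> l else 0)"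
    define b where "b = (\<lambda>l. if l \<le> 0 then \<Psi> l else 0)"
    have "expbd lm C a" "expbd (1 / lm) C b"
      using phi_bound_left psi_bound_left C_nonneg rates by (auto simp: expbd_def a_def b_def)
    from variation_of_constants_bounds[OF this assms rates(2) _ rates(6), of m] rates False
    have "cmod (b m * lsum (\<lambda>j. a j * f j) m) \<le> C * (C / (1 - lm * r)) * M * r ^ nat \<bar>m\<bar>"
      "cmod (a m * psum (\<lambda>j. b j * f j) m) \<le> C * (C * (r / lm) / (r / lm - 1)) * M * r ^ nat \<bar>m\<bar>"
      by auto
    moreover have "lsum (\<lambda>j. a j * f j) m = lsum (\<lambda>j. \<Phi> j * f j) m"
      "psum (\<lambda>j. b j * f j) m = psum (\<lambda>j. \<Psi> j * f j) m"
      using False by (simp_all add: lsum_def psum_def a_def b_def)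
    ultimately have "cmod (green0 f m) \<le> km * M * r ^ nat \<bar>m\<bar>"
      using False norm_triangle_ineq4[of "b m * lsum (\<lambda>j. a j * f j) m" "a m * psum (\<lambda>j. b j * f j) m"]
      by (simp add: green0_def a_def b_def km_def distrib_right)
    then show ?thesis by blast
  qed
  moreover have "kp * M * r ^ nat \<bar>m\<bar> \<le> KG0 * M * r ^ nat \<bar>m\<bar>" "km * M * r ^ nat \<bar>m\<bar> \<le> KG0 * M * r ^ nat \<bar>m\<bar>"
    using k M r_pos by (auto intro!: mult_right_mono)
  ultimately show "cmod (green0 f m) \<le> KG0 * M * r ^ nat \<bar>m\<bar>" by force
qed

lemma green0_diff:
  assumes "expbd r M f" "expbd r N g"
  shows "green0 (\<lambda>m. f m - g m) m = green0 f m - green0 g m"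
  using lsum_diff[OF expbd_Phi_mult[OF assms(1)] expbd_Phi_mult[OF assms(2)] lam_r, of m]
    rsum_diff[OF expbd_Phi_mult[OF assms(1)] expbd_Phi_mult[OF assms(2)] lam_r, of "m + 1"]
    psum_diff[of "\<lambda>l. \<Psi> l * f l" "\<lambda>l. \<Psi> l * g l" m]
  by (simp add: green0_def right_diff_distrib)

lemma jac_green0:
  assumes "expbd r M f" "ip f = 0"
  shows "jac p q (green0 f) m = f m"
proof -
  define h where "h = (\<lambda>l. \<Phi> l * f l)"
  define g where "g = (\<lambda>l. \<Psi> l * f l)"
  note hb = expbd_Phi_mult[OF assms(1), folded h_def]
  \<comment> \<open>Orthogonality to \<open>\<Phi>\<close> merges the two branches of
    \<open>green0\<close>.\<close>
  have "lsum h m = - rsum h (m + 1)" for m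
    using zsum_split[OF hb lam_r, of m] assms(2) by (simp add: ip_def h_def add_eq_0_iff2)
  then have G: "green0 f m = \<Psi> m * lsum h m - \<Phi> m * psum g m" for m
    by (simp add: green0_def h_def[symmetric] g_def[symmetric])
  have L: "lsum h (m - 1) = lsum h m - h m" "lsum h (m + 1) = lsum h m + h (m + 1)"
    using lsum_rec[OF hb lam_r, of m] lsum_rec[OF hb lam_r, of "m + 1"] by simp_all
  have P: "psum g (m - 1) = psum g m - g m" "psum g (m + 1) = psum g m + g (m + 1)"
    using psum_rec[of g m] psum_rec[of g "m + 1"] by simp_all
  \<comment> \<open>The sums are multiplied by \<open>J \<psi>\<close> and \<open>J \<phi>\<close>,
    the boundary terms at \<open>m + 1\<close> cancel, and those at \<open>m\<close> leave the
    Wronskian at \<open>m - 1\<close>. Its index is written \<open>m - 1 + 1\<close> to match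
    \<open>wronskian\<close>.\<close>
  have "jac p q (green0 f) m =
      of_real (p (m - 1) * \<psi> (m - 1) + q m * \<psi> m + p m * \<psi> (m + 1)) * lsum h m
      - of_real (p (m - 1) * \<phi> (m - 1) + q m * \<phi> m + p m * \<phi> (m + 1)) * psum g m
      + of_real (p (m - 1) * (\<phi> (m - 1) * \<psi> (m - 1 + 1) - \<phi> (m - 1 + 1) * \<psi> (m - 1))) * f m"
    unfolding jac_def G L P by (simp add: h_def g_def algebra_simps)
  then show ?thesis unfolding phi psi wronskian by simp
qed

text \<open>Removing the component along \<open>\<Phi>\<close> does not change the image under
  \<open>J\<close> and places the result in the orthogonal complement of
  \<open>\<Phi>\<close>.\<close>

definition green :: "(int \<Rightarrow> complex) \<Rightarrow> int \<Rightarrow> complex" where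
  "green f m = green0 f m - ip (green0 f) / of_real nrm * \<Phi> m"

definition Kip :: real where "Kip = 2 * C / (1 - lam * r)"

definition KG :: real where "KG = KG0 + Kip * KG0 / nrm * C"

lemma Kip_nonneg: "0 \<le> Kip"
  using C_nonneg lam_r by (simp add: Kip_def)

lemma KG_nonneg: "0 \<le> KG"
  using C_nonneg KG0_nonneg Kip_nonneg nrm_pos by (simp add: KG_def)

lemma green_bound:
  assumes "expbd r M f"
  shows "expbd r (KG * M) (green f)"
proof -
  have "cmod (ip (green0 f) / of_real nrm) \<le> Kip * (KG0 * M) / nrm"
    using ip_bound[OF green0_bound[OF assms]] nrm_pos
    by (simp add: norm_divide Kip_def[symmetric] divide_right_mono)
  from expbd_diff[OF green0_bound[OF assms] expbd_cmult[OF expbd_Phi this]]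
  show ?thesis by (simp add: green_def[abs_def] KG_def algebra_simps)
qed

lemma green_diff:
  assumes "expbd r M f" "expbd r N g"
  shows "green (\<lambda>m. f m - g m) m = green f m - green g m"
proof -
  have "green0 (\<lambda>m. f m - g m) = (\<lambda>m. green0 f m - green0 g m)"
    using green0_diff[OF assms] by blast
  then show ?thesis
    by (simp add: green_def ip_diff[OF green0_bound[OF assms(1)] green0_bound[OF assms(2)]]
        diff_divide_distrib left_diff_distrib)
qed

lemma ip_green:
  assumes "expbd r M f"
  shows "ip (green f) = 0"
proof -
  note g = green0_bound[OF assms]
  have "ip (green f) = ip (green0 f) - ip (green0 f) / of_real nrm * ip \<Phi>"
    unfolding green_def[abs_def] ip_diff[OF g expbd_cmult[OF expbd_Phi order_refl]]
      ip_cmult[OF expbd_Phi] ..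
  then show ?thesis using nrm_pos by (simp add: ip_Phi)
qed

lemma jac_Phi: "jac p q \<Phi> m = 0"
proof -
  have "jac p q \<Phi> m = of_real (p (m - 1) * \<phi> (m - 1) + q m * \<phi> m + p m * \<phi> (m + 1))"
    by (simp add: jac_def)
  then show ?thesis by (simp only: phi of_real_0)
qed

lemma jac_green:
  assumes "expbd r M f" "ip f = 0"
  shows "jac p q (green f) m = f m"
proof -
  have "jac p q (green f) m = jac p q (green0 f) m - ip (green0 f) / of_real nrm * jac p q \<Phi> m"
    by (simp add: jac_def green_def algebra_simps)
  then show ?thesis by (simp add: jac_Phi jac_green0[OF assms])
qed

end

section \<open>Bulk solutions\<close>

text \<open>Both \<open>\<mu> ^ n\<close> and \<open>(1 / \<mu>) ^ n\<close> solve the recurrence,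
  and \<open>\<mu> < 1\<close> makes them independent, so \<open>s 0\<close> and \<open>s 1\<close>
  determine \<open>a\<close> and \<open>b\<close>.\<close>

lemma linear_recurrence_solution:
  fixes s :: "nat \<Rightarrow> real"
  assumes mu: "0 < \<mu>" "\<mu> < 1" and rec: "\<And>n. s (n + 2) = (\<mu> + 1 / \<mu>) * s (n + 1) - s n"
  shows "\<exists>a b. \<forall>n. s n = a * \<mu> ^ n + b * (1 / \<mu>) ^ n"
proof -
  define D where "D = 1 / \<mu> - \<mu>"
  have "\<mu> * \<mu> < 1 * 1" using mu by (intro mult_strict_mono) auto
  then have D: "D \<noteq> 0" using mu by (simp add: D_def field_simps)
  define b where "b = (s 1 - \<mu> * s 0) / D"
  define a where "a = s 0 - b"
  have bD: "b * D = s 1 - \<mu> * s 0" using D by (simp add: b_def)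
  have "s n = a * \<mu> ^ n + b * (1 / \<mu>) ^ n \<and> s (Suc n) = a * \<mu> ^ Suc n + b * (1 / \<mu>) ^ Suc n" for n
  proof (induction n)
    case 0
    have "a * \<mu> + b * (1 / \<mu>) = \<mu> * s 0 + b * D" by (simp add: a_def D_def algebra_simps)
    then show ?case unfolding bD by (simp add: a_def)
  next
    case (Suc n)
    have "s (Suc (Suc n)) = (\<mu> + 1 / \<mu>) * s (Suc n) - s n" using rec[of n] by simp
    also have "\<dots> = a * \<mu> ^ Suc (Suc n) + b * (1 / \<mu>) ^ Suc (Suc n)"
    proof -
      define \<nu> where "\<nu> = 1 / \<mu>"
      have e: "\<mu> * \<nu> = 1" using mu by (simp add: \<nu>_def)
      have "(\<mu> + \<nu>) * (a * \<mu> ^ Suc n + b * \<nu> ^ Suc n) - (a * \<mu> ^ n + b * \<nu> ^ n)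
          = a * \<mu> ^ Suc (Suc n) + b * \<nu> ^ Suc (Suc n) + (\<mu> * \<nu> - 1) * (a * \<mu> ^ n + b * \<nu> ^ n)"
        by (simp add: algebra_simps)
      then show ?thesis using Suc by (simp add: \<nu>_def[symmetric] e)
    qed
    finally show ?case using Suc by simp
  qed
  then show ?thesis by blast
qed

lemma linear_recurrence_growth:
  fixes s :: "nat \<Rightarrow> real"
  assumes mu: "0 < \<mu>" "\<mu> < 1" and rec: "\<And>n. s (n + 2) = (\<mu> + 1 / \<mu>) * s (n + 1) - s n"
  shows "\<exists>A. \<forall>n. \<bar>s n\<bar> \<le> A * (1 / \<mu>) ^ n"
proof -
  obtain a b where s: "\<And>n. s n = a * \<mu> ^ n + b * (1 / \<mu>) ^ n"
    using linear_recurrence_solution[OF assms] by blast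
  have "\<bar>s n\<bar> \<le> (\<bar>a\<bar> + \<bar>b\<bar>) * (1 / \<mu>) ^ n" for n
  proof -
    have "\<mu> ^ n \<le> (1 / \<mu>) ^ n" using mu mult_mono[of \<mu> 1 \<mu> 1] by (intro power_mono) (auto simp: field_simps)
    then have "\<bar>a\<bar> * \<mu> ^ n \<le> \<bar>a\<bar> * (1 / \<mu>) ^ n" by (rule mult_left_mono) simp
    moreover have "\<bar>s n\<bar> \<le> \<bar>a\<bar> * \<mu> ^ n + \<bar>b\<bar> * (1 / \<mu>) ^ n"
      unfolding s using mu by (intro order_trans[OF abs_triangle_ineq]) (simp add: abs_mult power_abs)
    ultimately show ?thesis by (simp add: distrib_right)
  qed
  then show ?thesis by blast
qed

lemma linear_recurrence_decay:
  fixes s :: "nat \<Rightarrow> real"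
  assumes mu: "0 < \<mu>" "\<mu> < 1" and rec: "\<And>n. s (n + 2) = (\<mu> + 1 / \<mu>) * s (n + 1) - s n"
    and lim: "s \<longlonglongrightarrow> 0"
  shows "\<exists>A. \<forall>n. \<bar>s n\<bar> \<le> A * \<mu> ^ n"
proof -
  obtain a b where s: "\<And>n. s n = a * \<mu> ^ n + b * (1 / \<mu>) ^ n"
    using linear_recurrence_solution[OF assms(1-3)] by blast
  have m0: "(\<lambda>n. \<mu> ^ n) \<longlonglongrightarrow> 0" using mu by (intro LIMSEQ_realpow_zero) auto
  \<comment> \<open>Multiplication by \<open>\<mu> ^ n\<close> isolates the coefficient
    \<open>b\<close> of the growing solution as a limit.\<close>
  have "(\<lambda>n. \<mu> ^ n * s n) \<longlonglongrightarrow> 0 * 0" by (intro tendsto_mult m0 lim)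
  moreover have "\<mu> ^ n * s n = a * (\<mu> ^ n * \<mu> ^ n) + b" for n
    using mu by (simp add: s distrib_left power_one_over mult_ac)
  ultimately have "(\<lambda>n. a * (\<mu> ^ n * \<mu> ^ n) + b) \<longlonglongrightarrow> 0" by simp
  moreover have "(\<lambda>n. a * (\<mu> ^ n * \<mu> ^ n) + b) \<longlonglongrightarrow> a * (0 * 0) + b"
    by (intro tendsto_intros m0)
  ultimately have "b = 0" using LIMSEQ_unique by fastforce
  then have "\<bar>s n\<bar> \<le> \<bar>a\<bar> * \<mu> ^ n" for n using mu by (simp add: s abs_mult power_abs)
  then show ?thesis by blast
qed

text \<open>The characteristic root \<open>1\<close> is double: solutions are affine in
  \<open>n\<close>, and an affine sequence tending to \<open>0\<close> is zero.\<close>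

lemma linear_recurrence_parabolic:
  fixes s :: "nat \<Rightarrow> real"
  assumes rec: "\<And>n. s (n + 2) = 2 * s (n + 1) - s n" and lim: "s \<longlonglongrightarrow> 0"
  shows "s n = 0"
proof -
  have step: "s (Suc n) - s n = s 1 - s 0" for n
  proof (induction n)
    case (Suc n)
    then show ?case using rec[of n] by simp
  qed simp
  have "(\<lambda>n. s (Suc n) - s n) \<longlonglongrightarrow> 0 - 0"
    by (intro tendsto_diff lim LIMSEQ_Suc)
  then have "(\<lambda>n::nat. s 1 - s 0) \<longlonglongrightarrow> 0" unfolding step by simp
  then have "s 1 - s 0 = 0" using LIMSEQ_unique tendsto_const by blast
  then have const: "s (Suc n) = s n" for n using step[of n] by simp
  have "s n = s 0" for n by (induction n) (auto simp: const)
  then have "s = (\<lambda>n. s 0)" by blast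
  then have "(\<lambda>n::nat. s 0) \<longlonglongrightarrow> 0" using lim by simp
  then have "s 0 = 0" using LIMSEQ_unique tendsto_const by blast
  then show ?thesis using \<open>\<And>n. s n = s 0\<close> by simp
qed

text \<open>The rows are read away from the interface; the mirror symmetry of a cell makes them the same on
  both sides.\<close>

definition halfline :: "real \<Rightarrow> real \<Rightarrow> (nat \<Rightarrow> real) \<Rightarrow> bool" where
  "halfline b d g \<longleftrightarrow> (\<forall>n. b * g (3 * n) + d * g (3 * n + 1) + b * g (3 * n + 2) = 0 \<and>
     b * g (3 * n + 1) + b * g (3 * n + 2) + d * g (3 * n + 3) = 0 \<and>
     d * g (3 * n + 2) + b * g (3 * n + 3) + b * g (3 * n + 4) = 0)"

text \<open>The trace of the transfer matrix across one cell, which has determinant one.\<close>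

definition htrace :: "real \<Rightarrow> real \<Rightarrow> real" where
  "htrace b d = (d / b)\<^sup>2 + 2 * (b / d) - 1"

text \<open>Clearing denominators turns \<open>htrace b d - 2\<close> into the cubic
  \<open>(d - b)^2 * (d + 2 * b)\<close>, so the parabolic case is \<open>b = d\<close>.\<close>

lemma htrace_ge_2:
  assumes "b > 0" "d > 0"
  shows "htrace b d \<ge> 2" and "htrace b d = 2 \<Longrightarrow> b = d"
proof -
  have e: "(htrace b d - 2) * (b\<^sup>2 * d) = (d - b)\<^sup>2 * (d + 2 * b)"
    using assms by (simp add: htrace_def field_simps power2_eq_square)
  have p: "b\<^sup>2 * d > 0" using assms by simp
  have "(htrace b d - 2) * (b\<^sup>2 * d) \<ge> 0" unfolding e using assms by simp
  then show "htrace b d \<ge> 2" using p by (simp add: zero_le_mult_iff)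
  show "b = d" if "htrace b d = 2" using e that assms by simp
qed

text \<open>The Cayley--Hamilton relation for the transfer matrix over one cell, obtained by
  elimination: the middle site is a combination of the outer two, which satisfy a first-order system
  from cell to cell.\<close>

lemma halfline_recurrence:
  assumes "halfline b d g" "b > 0" "d > 0" "j < 3"
  shows "g (3 * (n + 2) + j) = htrace b d * g (3 * (n + 1) + j) - g (3 * n + j)"
proof -
  define t where "t = b / d"
  have t: "t > 0" using assms by (simp add: t_def)
  have "htrace b d = 1 / t^2 + 2 * t - 1" by (simp add: htrace_def t_def power_divide)
  have T: "htrace b d * t^2 = 1 + 2 * t^3 - t^2"
    unfolding \<open>htrace b d = _\<close> using t by (simp add: field_simps power2_eq_square power3_eq_cube)
  have b: "b = t * d" using assms by (simp add: t_def)
  have R: "t * g (3 * n) + g (3 * n + 1) + t * g (3 * n + 2) = 0"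
    "t * g (3 * n + 1) + t * g (3 * n + 2) + g (3 * n + 3) = 0"
    "g (3 * n + 2) + t * g (3 * n + 3) + t * g (3 * n + 4) = 0" for n
  proof -
    have "d * (t * g (3 * n) + g (3 * n + 1) + t * g (3 * n + 2)) = 0"
      "d * (t * g (3 * n + 1) + t * g (3 * n + 2) + g (3 * n + 3)) = 0"
      "d * (g (3 * n + 2) + t * g (3 * n + 3) + t * g (3 * n + 4)) = 0"
      using assms(1) by (auto simp: halfline_def b algebra_simps)
    then show "t * g (3 * n) + g (3 * n + 1) + t * g (3 * n + 2) = 0"
      "t * g (3 * n + 1) + t * g (3 * n + 2) + g (3 * n + 3) = 0"
      "g (3 * n + 2) + t * g (3 * n + 3) + t * g (3 * n + 4) = 0" using assms(3) by auto
  qed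
  define x where "x = (\<lambda>n. g (3 * n))"
  define y where "y = (\<lambda>n. g (3 * n + 1))"
  define z where "z = (\<lambda>n. g (3 * n + 2))"
  have e: "3 * (n + 1) = 3 * n + 3" "3 * (n + 1) + 1 = 3 * n + 4" for n :: nat by simp_all
  have r1: "y n = - t * (x n + z n)" for n using R(1)[of n] by (simp add: x_def y_def z_def algebra_simps)
  have r2: "x (n + 1) = - t * (y n + z n)" for n
    using R(2)[of n] unfolding x_def y_def z_def e by (simp add: algebra_simps)
  have r3: "z n = - t * (x (n + 1) + y (n + 1))" for n
    using R(3)[of n] unfolding x_def y_def z_def e by (simp add: algebra_simps)
  \<comment> \<open>\<open>X\<close> and \<open>Z\<close> relate the pairs \<open>(x, z)\<close> of
    neighbouring cells; combining two consecutive cells eliminates one of the two unknowns.\<close>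
  have X: "x (n + 1) = t^2 * x n - t * (1 - t) * z n" for n
    unfolding r2 r1 by (simp add: algebra_simps power2_eq_square)
  have Z: "t^2 * z (n + 1) = z n + t * (1 - t) * x (n + 1)" for n
    using r3[of n] unfolding r1[of "n + 1"] by (simp add: algebra_simps power2_eq_square)
  have Xr: "x (n + 2) = htrace b d * x (n + 1) - x n" for n
  proof -
    have "t^2 * x (n + 2) = t^2 * (t^2 * x (n + 1)) - t * (1 - t) * (t^2 * z (n + 1))"
    proof -
      have "x (n + 2) = t^2 * x (n + 1) - t * (1 - t) * z (n + 1)" using X[of "n + 1"] by simp
      then show ?thesis by (simp only: right_diff_distrib) (simp only: mult.left_commute)
    qed
    also have "\<dots> = (t^4 - t^2 * (1 - t)^2) * x (n + 1) - t * (1 - t) * z n"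
      unfolding Z by (simp add: algebra_simps power2_eq_square power4_eq_xxxx)
    also have "\<dots> = (t^4 - t^2 * (1 - t)^2 + 1) * x (n + 1) - t^2 * x n"
      using X[of n] by (simp add: algebra_simps)
    also have "t^4 - t^2 * (1 - t)^2 + 1 = htrace b d * t^2"
      unfolding T by (simp add: algebra_simps power2_eq_square power3_eq_cube power4_eq_xxxx)
    finally have "t^2 * x (n + 2) = t^2 * (htrace b d * x (n + 1) - x n)" by (simp add: algebra_simps)
    then show ?thesis using t by simp
  qed
  have Zr: "z (n + 2) = htrace b d * z (n + 1) - z n" for n
  proof -
    have "t^2 * z (n + 2) = z (n + 1) + t * (1 - t) * x (n + 1 + 1)"
      using Z[of "n + 1"] by simp
    also have "\<dots> = z (n + 1) + t * (1 - t) * (t^2 * x (n + 1) - t * (1 - t) * z (n + 1))"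
      by (simp only: X)
    also have "\<dots> = (1 - t^2 * (1 - t)^2) * z (n + 1) + t^2 * (t * (1 - t) * x (n + 1))"
      by (simp add: algebra_simps power2_eq_square)
    also have "t * (1 - t) * x (n + 1) = t^2 * z (n + 1) - z n" using Z[of n] by simp
    also have "(1 - t^2 * (1 - t)^2) * z (n + 1) + t^2 * (t^2 * z (n + 1) - z n)
        = htrace b d * t^2 * z (n + 1) - t^2 * z n"
      unfolding T by (simp add: algebra_simps power2_eq_square power3_eq_cube power4_eq_xxxx)
    finally have "t^2 * z (n + 2) = t^2 * (htrace b d * z (n + 1) - z n)" by (simp add: algebra_simps)
    then show ?thesis using t by simp
  qed
  have Yr: "y (n + 2) = htrace b d * y (n + 1) - y n" for n
    unfolding r1 Xr Zr by (simp add: algebra_simps)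
  from assms(4) consider "j = 0" | "j = 1" | "j = 2" by linarith
  then show ?thesis
    using Xr[of n] Yr[of n] Zr[of n] by cases (simp_all add: x_def y_def z_def)
qed

text \<open>The smaller root of \<open>\<mu>^2 - \<tau> * \<mu> + 1\<close>; the product of the
  roots is one, so the other root is \<open>1 / \<mu> > 1\<close>.\<close>

lemma hyperbolic_root:
  fixes \<tau> :: real
  assumes "\<tau> > 2"
  shows "\<exists>\<mu>. 0 < \<mu> \<and> \<mu> < 1 \<and> \<tau> = \<mu> + 1 / \<mu>"
proof -
  define s where "s = sqrt (\<tau>\<^sup>2 - 4)"
  have "4 < \<tau>\<^sup>2" using power_strict_mono[of 2 \<tau> 2] assms by simp
  then have s2: "s\<^sup>2 = \<tau>\<^sup>2 - 4" and s0: "s > 0" by (auto simp: s_def)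
  have "s < \<tau>" using s2 assms by (intro power_less_imp_less_base[of s 2 \<tau>]) auto
  define \<mu> where "\<mu> = (\<tau> - s) / 2"
  have pos: "\<mu> > 0" using \<open>s < \<tau>\<close> by (simp add: \<mu>_def)
  have "\<mu> * ((\<tau> + s) / 2) = 1" using s2 by (simp add: \<mu>_def field_simps power2_eq_square)
  then have inv: "1 / \<mu> = (\<tau> + s) / 2" using pos by (simp add: field_simps)
  then have "\<tau> = \<mu> + 1 / \<mu>" by (simp add: \<mu>_def field_simps)
  moreover have "1 < 1 / \<mu>" unfolding inv using assms s0 by simp
  then have "\<mu> < 1" using pos by simp
  ultimately show ?thesis using pos by blast
qed

text \<open>Turns a rate per cell of three sites into a rate per site; the position \<open>j\<close>
  in the cell costs \<open>1 / L ^ j\<close>.\<close>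

lemma cellwise_bound:
  fixes g :: "nat \<Rightarrow> real"
  assumes "L > 0" "\<And>j. j < 3 \<Longrightarrow> \<exists>A. \<forall>n. \<bar>g (3 * n + j)\<bar> \<le> A * (L ^ 3) ^ n"
  shows "\<exists>A. \<forall>n. \<bar>g n\<bar> \<le> A * L ^ n"
proof -
  have "\<forall>j\<in>{..<3}. \<exists>A. \<forall>n. \<bar>g (3 * n + j)\<bar> \<le> A * (L ^ 3) ^ n"
    using assms(2) by simp
  from bchoice[OF this] obtain A where A: "\<And>j n. j < 3 \<Longrightarrow> \<bar>g (3 * n + j)\<bar> \<le> A j * (L ^ 3) ^ n"
    by auto
  define B where "B = (\<Sum>j<3. \<bar>A j\<bar> / L ^ j)"
  have "\<bar>g n\<bar> \<le> B * L ^ n" for n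
  proof -
    define j where "j = n mod 3"
    have j: "j < 3" "n = 3 * (n div 3) + j" by (auto simp: j_def)
    have "\<bar>g n\<bar> \<le> A j * (L ^ 3) ^ (n div 3)" using A[OF j(1), of "n div 3"] j(2) by simp
    also have "\<dots> \<le> \<bar>A j\<bar> * (L ^ 3) ^ (n div 3)"
      using assms(1) by (intro mult_right_mono) auto
    also have "\<dots> = \<bar>A j\<bar> / L ^ j * L ^ n"
    proof -
      have "L ^ n = L ^ (3 * (n div 3)) * L ^ j" by (subst j(2)) (simp add: power_add)
      then show ?thesis using assms(1) by (simp add: power_mult)
    qed
    also have "\<dots> \<le> B * L ^ n"
      unfolding B_def using assms(1) j(1)
      by (intro mult_right_mono member_le_sum[of j "{..<3}" "\<lambda>j. \<bar>A j\<bar> / L ^ j"]) auto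
    finally show ?thesis .
  qed
  then show ?thesis by blast
qed

text \<open>For \<open>b \<noteq> d\<close> the trace exceeds two, and \<open>L\<close> is the cube
  root of the smaller eigenvalue of the cell transfer matrix. One \<open>L\<close> serves all
  solutions, so the growth of a second solution is matched to the decay of the first.\<close>

lemma halfline_dichotomy:
  assumes "b > 0" "d > 0" "b \<noteq> d"
  shows "\<exists>L. 0 < L \<and> L < 1 \<and>
    (\<forall>g. halfline b d g \<longrightarrow> (\<exists>A. \<forall>n. \<bar>g n\<bar> \<le> A * (1 / L) ^ n)) \<and>
    (\<forall>g. halfline b d g \<and> g \<longlonglongrightarrow> 0 \<longrightarrow> (\<exists>A. \<forall>n. \<bar>g n\<bar> \<le> A * L ^ n))"
proof -
  have "htrace b d > 2" using htrace_ge_2[OF assms(1,2)] assms(3) by fastforce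
  then obtain \<mu> where mu: "0 < \<mu>" "\<mu> < 1" "htrace b d = \<mu> + 1 / \<mu>"
    using hyperbolic_root by blast
  define L where "L = root 3 \<mu>"
  have L: "0 < L" "L < 1" "L ^ 3 = \<mu>" using mu by (auto simp: L_def)
  have rec: "g (3 * (n + 2) + j) = (\<mu> + 1 / \<mu>) * g (3 * (n + 1) + j) - g (3 * n + j)"
    if "halfline b d g" "j < 3" for g n j
    using halfline_recurrence[OF that(1) assms(1,2) that(2)] by (simp only: mu(3))
  have "\<exists>A. \<forall>n. \<bar>g n\<bar> \<le> A * (1 / L) ^ n" if "halfline b d g" for g
  proof (rule cellwise_bound)
    fix j :: nat assume "j < 3"
    from linear_recurrence_growth[OF mu(1,2), of "\<lambda>n. g (3 * n + j)", OF rec[OF that this]]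
    show "\<exists>A. \<forall>n. \<bar>g (3 * n + j)\<bar> \<le> A * ((1 / L) ^ 3) ^ n"
      by (simp add: power_one_over L(3))
  qed (use L in simp)
  moreover have "\<exists>A. \<forall>n. \<bar>g n\<bar> \<le> A * L ^ n" if "halfline b d g" "g \<longlonglongrightarrow> 0" for g
  proof (rule cellwise_bound[OF L(1)])
    fix j :: nat assume j: "j < 3"
    have "strict_mono (\<lambda>n. 3 * n + j)" by (auto simp: strict_mono_def)
    then have "(\<lambda>n. g (3 * n + j)) \<longlonglongrightarrow> 0"
      using LIMSEQ_subseq_LIMSEQ[OF that(2)] by (simp add: o_def)
    from linear_recurrence_decay[OF mu(1,2), of "\<lambda>n. g (3 * n + j)", OF rec[OF that(1) j] this]
    show "\<exists>A. \<forall>n. \<bar>g (3 * n + j)\<bar> \<le> A * (L ^ 3) ^ n" by (simp add: L(3))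
  qed
  ultimately show ?thesis using L by blast
qed

text \<open>At \<open>b = d\<close> the trace is two. This excludes \<open>b = d\<close> on either
  side of an interface that carries a decaying zero mode.\<close>

lemma halfline_parabolic:
  assumes "halfline b b g" "b > 0" "g \<longlonglongrightarrow> 0"
  shows "g n = 0"
proof -
  define j where "j = n mod 3"
  have j: "j < 3" "n = 3 * (n div 3) + j" by (auto simp: j_def)
  have "strict_mono (\<lambda>n. 3 * n + j)" by (auto simp: strict_mono_def)
  then have "(\<lambda>n. g (3 * n + j)) \<longlonglongrightarrow> 0"
    using LIMSEQ_subseq_LIMSEQ[OF assms(3)] by (simp add: o_def)
  moreover have tr: "htrace b b = 2" using assms(2) by (simp add: htrace_def)
  note halfline_recurrence[OF assms(1,2,2) j(1), unfolded tr]
  ultimately have "g (3 * (n div 3) + j) = 0"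
    by (intro linear_recurrence_parabolic[of "\<lambda>n. g (3 * n + j)"])
  then show ?thesis by (simp only: j(2)[symmetric])
qed

section \<open>Solutions of a general Jacobi recurrence\<close>

lemma jacobi_solution_exists:
  fixes p q :: "int \<Rightarrow> real"
  assumes p: "\<And>m. p m \<noteq> 0"
  shows "\<exists>f. f 0 = a \<and> f 1 = b \<and> (\<forall>m. p (m - 1) * f (m - 1) + q m * f m + p m * f (m + 1) = 0)"
proof -
  \<comment> \<open>The states are pairs of neighbouring values: \<open>F n\<close> is
    \<open>(f n, f (n + 1))\<close> and \<open>G n\<close> is \<open>(f (- n), f (- n + 1))\<close>.
    Both start from \<open>(f 0, f 1)\<close>, running right and left.\<close>
  define F where "F = rec_nat (a, b) (\<lambda>n (x, y). (y, - (p (int n) * x + q (int n + 1) * y) / p (int n + 1)))"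
  define G where "G = rec_nat (a, b) (\<lambda>n (x, y). (- (q (- int n) * x + p (- int n) * y) / p (- int n - 1), x))"
  have F: "F 0 = (a, b)" "F (Suc n) = (snd (F n), - (p (int n) * fst (F n) + q (int n + 1) * snd (F n)) / p (int n + 1))" for n
    by (auto simp: F_def split: prod.split)
  have G: "G 0 = (a, b)" "G (Suc n) = (- (q (- int n) * fst (G n) + p (- int n) * snd (G n)) / p (- int n - 1), fst (G n))" for n
    by (auto simp: G_def split: prod.split)
  define f where "f m = (if m \<ge> 0 then fst (F (nat m)) else fst (G (nat (- m))))" for m
  have f0: "f 0 = a" by (simp add: f_def F)
  have f1: "f 1 = b" by (simp add: f_def F)
  have fF: "f (int n) = fst (F n)" for n by (simp add: f_def)
  have fG: "f (- int n) = fst (G n)" for n by (cases n) (auto simp: f_def F G simp del: of_nat_Suc)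
  have fF1: "f (int n + 1) = snd (F n)" for n
    using fF[of "Suc n"] by (simp add: F add.commute)
  have fG1: "f (- int n + 1) = snd (G n)" for n
  proof (cases n)
    case 0 then show ?thesis by (simp add: G f1)
  next
    case (Suc k)
    then have "- int n + 1 = - int k" by simp
    then show ?thesis using fG[of k] Suc by (simp add: G)
  qed
  have "p (m - 1) * f (m - 1) + q m * f m + p m * f (m + 1) = 0" for m
  proof (cases "m > 0")
    case True
    define n where "n = nat (m - 1)"
    have m: "m = int n + 1" using True by (simp add: n_def)
    have "f (m + 1) = - (p (int n) * f (int n) + q (int n + 1) * f (int n + 1)) / p (int n + 1)"
    proof -
      have "int (Suc n) + 1 = m + 1" by (simp add: m)
      then have "f (m + 1) = snd (F (Suc n))" using fF1[of "Suc n"] by (simp only:)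
      then show ?thesis by (simp only: F snd_conv fF fF1)
    qed
    then show ?thesis using p[of "int n + 1"] by (simp add: m)
  next
    case False
    define n where "n = nat (- m)"
    have m: "m = - int n" using False by (simp add: n_def)
    have "f (m - 1) = - (q (- int n) * f (- int n) + p (- int n) * f (- int n + 1)) / p (- int n - 1)"
    proof -
      have "- int (Suc n) = m - 1" by (simp add: m)
      then have "f (m - 1) = fst (G (Suc n))" using fG[of "Suc n"] by (simp only:)
      then show ?thesis by (simp only: G fst_conv fG fG1)
    qed
    then show ?thesis using p[of "- int n - 1"] by (simp add: m)
  qed
  then show ?thesis using f0 f1 by blast
qed

text \<open>Cross-multiplying the two recurrences and subtracting cancels the diagonal, which leaves
  equal Wronskians on neighbouring bonds.\<close>

lemma jacobi_wronskian_const: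
  fixes p q f g :: "int \<Rightarrow> real"
  assumes f: "\<And>m. p (m - 1) * f (m - 1) + q m * f m + p m * f (m + 1) = 0"
    and g: "\<And>m. p (m - 1) * g (m - 1) + q m * g m + p m * g (m + 1) = 0"
  shows "p m * (f m * g (m + 1) - f (m + 1) * g m) = p 0 * (f 0 * g 1 - f 1 * g 0)"
proof -
  have step: "p m * (f m * g (m + 1) - f (m + 1) * g m) = p (m - 1) * (f (m - 1) * g m - f m * g (m - 1))" for m
  proof -
    have "f m * (p (m - 1) * g (m - 1) + q m * g m + p m * g (m + 1))
        - g m * (p (m - 1) * f (m - 1) + q m * f m + p m * f (m + 1)) = 0" by (simp add: f g)
    then show ?thesis by (simp add: algebra_simps)
  qed
  show ?thesis
  proof (induction m rule: int_induct[where k = 0])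
    case (step1 i)
    then show ?case using step[of "i + 1"] by simp
  next
    case (step2 i)
    then show ?case using step[of i] by simp
  qed simp
qed

text \<open>Two neighbouring zeros propagate in both directions because the recurrence can be solved
  for either outer value.\<close>

lemma jacobi_solution_unique:
  fixes p q f :: "int \<Rightarrow> real"
  assumes p: "\<And>m. p m \<noteq> 0"
    and f: "\<And>m. p (m - 1) * f (m - 1) + q m * f m + p m * f (m + 1) = 0"
    and z: "f l = 0" "f (l + 1) = 0"
  shows "f m = 0"
proof -
  have "f m = 0 \<and> f (m + 1) = 0"
  proof (induction m rule: int_induct[where k = l])
    case (step1 i)
    then show ?case using f[of "i + 1"] p[of "i + 1"] by simp
  next
    case (step2 i)
    then show ?case using f[of i] p[of "i - 1"] by simp
  qed (use z in simp)
  then show ?thesis ..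
qed

section \<open>Lyapunov--Schmidt reduction\<close>

lemma cis_minus_1_bound: "cmod (cis x - 1) \<le> \<bar>x\<bar>"
  using Taylor_exp[of "\<i> * of_real x" 0] by (simp add: cis_conv_exp norm_mult)

lemma cis_minus_linear_bound: "cmod (cis x - 1 - \<i> * of_real x) \<le> x\<^sup>2"
  using Taylor_exp[of "\<i> * of_real x" 1] by (simp add: cis_conv_exp norm_mult diff_diff_eq power2_eq_square)

locale jacobi_perturbation = jacobi_zero_mode +
  fixes dd cc :: "int \<Rightarrow> real" and B :: real
  assumes dd_bound: "\<And>m. \<bar>dd m\<bar> \<le> B" and cc_bound: "\<And>m. \<bar>cc m\<bar> \<le> B"
begin

definition dop :: "(int \<Rightarrow> complex) \<Rightarrow> int \<Rightarrow> complex" where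
  "dop f m = of_real (dd m) * f m"

definition cop :: "(int \<Rightarrow> complex) \<Rightarrow> int \<Rightarrow> complex" where
  "cop f m = of_real (cc m) * f (m + 1) + of_real (cc (m - 1)) * f (m - 1)"

text \<open>In the application \<open>dd\<close> holds the middle diagonal entries, with phase
  \<open>cis k\<close>, and \<open>cc\<close> the intercell bonds, to which the gauge gives
  \<open>cis (- k / 2)\<close> in both directions. Subtracting one from each phase leaves the
  deviation from \<open>J\<close>.\<close>

definition pert :: "real \<Rightarrow> (int \<Rightarrow> complex) \<Rightarrow> int \<Rightarrow> complex" where
  "pert k f m = (cis k - 1) * dop f m + (cis (- k / 2) - 1) * cop f m"

definition KB :: real where "KB = B + B / r"

lemma B_nonneg: "0 \<le> B" using dd_bound[of 0] by linarith

lemma KB_nonneg: "0 \<le> KB" using B_nonneg r_pos by (simp add: KB_def)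

lemma expbd_coeff_mult:
  assumes "expbd r M f" "\<And>m. \<bar>x m\<bar> \<le> B"
  shows "expbd r (B * M) (\<lambda>m. of_real (x m) * f m)"
  using expbd_mult[OF _ assms(1), of 1 B "\<lambda>m. of_real (x m)"] assms(2) by (simp add: expbd_def)

lemma dop_bound: "expbd r M f \<Longrightarrow> expbd r (B * M) (dop f)"
  unfolding dop_def[abs_def] by (rule expbd_coeff_mult[OF _ dd_bound])

lemma cop_bound:
  assumes "expbd r M f"
  shows "expbd r (2 * (B / r) * M) (cop f)"
proof -
  have "expbd r (M / r) (\<lambda>m. f (m + 1))" "expbd r (M / r) (\<lambda>m. f (m - 1))"
    using expbd_shift[OF assms r_pos rates(6), of 1] expbd_shift[OF assms r_pos rates(6), of "-1"]
    by auto
  then have "expbd r (B * (M / r) + B * (M / r)) (cop f)"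
    unfolding cop_def[abs_def] by (intro expbd_add expbd_coeff_mult cc_bound)
  then show ?thesis by (simp add: mult_ac)
qed

lemma pert_bound:
  assumes "expbd r M f"
  shows "expbd r (KB * \<bar>k\<bar> * M) (pert k f)"
proof -
  have "cmod (cis (- k / 2) - 1) \<le> \<bar>k\<bar> / 2" using cis_minus_1_bound[of "- k / 2"] by simp
  from expbd_add[OF expbd_cmult[OF dop_bound[OF assms] cis_minus_1_bound[of k]]
      expbd_cmult[OF cop_bound[OF assms] this]]
  show ?thesis by (simp add: pert_def[abs_def] KB_def algebra_simps)
qed

lemma pert_diff: "pert k (\<lambda>m. f m - g m) m = pert k f m - pert k g m"
  by (simp add: pert_def dop_def cop_def algebra_simps)

lemma pert_add: "pert k (\<lambda>m. f m + g m) m = pert k f m + pert k g m"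
  by (simp add: pert_def dop_def cop_def algebra_simps)

lemma ip_pert:
  assumes "expbd r M f"
  shows "ip (pert k f) = (cis k - 1) * ip (dop f) + (cis (- k / 2) - 1) * ip (cop f)"
  unfolding pert_def[abs_def]
    ip_add[OF expbd_cmult[OF dop_bound[OF assms] order_refl] expbd_cmult[OF cop_bound[OF assms] order_refl]]
    ip_cmult[OF dop_bound[OF assms]] ip_cmult[OF cop_bound[OF assms]] ..

lemma ip_bound': "expbd r M f \<Longrightarrow> cmod (ip f) \<le> Kip * M"
  unfolding Kip_def by (rule ip_bound)

text \<open>This value is the bifurcation equation: for \<open>w\<close> orthogonal to
  \<open>\<Phi>\<close> it makes \<open>rhs k w\<close> orthogonal to \<open>\<Phi>\<close> as well,
  which is what \<open>jac_green\<close> requires.\<close>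

definition eps :: "real \<Rightarrow> (int \<Rightarrow> complex) \<Rightarrow> complex" where
  "eps k w = ip (pert k (\<lambda>m. \<Phi> m + w m)) / of_real nrm"

definition rhs :: "real \<Rightarrow> (int \<Rightarrow> complex) \<Rightarrow> int \<Rightarrow> complex" where
  "rhs k w m = eps k w * cnj (\<Phi> m + w m) - pert k (\<lambda>m. \<Phi> m + w m) m"

text \<open>On the unit ball, where \<open>\<Phi> + w\<close> has bound \<open>C + 1\<close>, the
  constants \<open>K4\<close>, \<open>K5\<close> and \<open>K6\<close> times \<open>|k|\<close>
  bound \<open>eps\<close>, the map \<open>green (rhs k w)\<close> and its Lipschitz
  constant.\<close>

definition K4 :: real where "K4 = Kip * KB * (C + 1) / nrm"

definition K5 :: real where "K5 = KG * (K4 * (C + 1) + KB * (C + 1))"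

definition K6 :: real where "K6 = KG * (Kip * KB / nrm * (C + 1) + K4 + KB)"

lemma K_nonneg: "0 \<le> K4" "0 \<le> K5" "0 \<le> K6"
  using C_nonneg KG_nonneg Kip_nonneg nrm_pos KB_nonneg
  by (auto simp: K4_def K5_def K6_def intro!: mult_nonneg_nonneg add_nonneg_nonneg divide_nonneg_nonneg)

lemma eps_bound:
  assumes "expbd r 1 w"
  shows "cmod (eps k w) \<le> K4 * \<bar>k\<bar>"
proof -
  have "cmod (ip (pert k (\<lambda>m. \<Phi> m + w m))) \<le> Kip * (KB * \<bar>k\<bar> * (C + 1))"
    by (intro ip_bound' pert_bound expbd_add expbd_Phi assms)
  then have "cmod (eps k w) \<le> Kip * (KB * \<bar>k\<bar> * (C + 1)) / nrm"
    using nrm_pos by (simp add: eps_def norm_divide divide_right_mono)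
  then show ?thesis by (simp add: K4_def mult_ac)
qed

lemma rhs_bound:
  assumes "expbd r 1 w"
  shows "expbd r (K4 * \<bar>k\<bar> * (C + 1) + KB * \<bar>k\<bar> * (C + 1)) (rhs k w)"
  unfolding rhs_def[abs_def]
  by (intro expbd_diff expbd_cmult expbd_cnj pert_bound expbd_add expbd_Phi assms eps_bound)

lemma ip_rhs:
  assumes "expbd r 1 w" "ip w = 0"
  shows "ip (rhs k w) = 0"
proof -
  have v: "expbd r (C + 1) (\<lambda>m. \<Phi> m + w m)" by (intro expbd_add expbd_Phi assms)
  have "ip (rhs k w) = eps k w * cnj (ip (\<lambda>m. \<Phi> m + w m)) - ip (pert k (\<lambda>m. \<Phi> m + w m))"
    unfolding rhs_def[abs_def] ip_diff[OF expbd_cmult[OF expbd_cnj[OF v] order_refl] pert_bound[OF v]]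
      ip_cmult[OF expbd_cnj[OF v]] ip_cnj[OF v] ..
  also have "ip (\<lambda>m. \<Phi> m + w m) = of_real nrm"
    using ip_add[OF expbd_Phi assms(1)] by (simp add: assms(2) ip_Phi)
  finally show ?thesis using nrm_pos by (simp add: eps_def)
qed

lemma green_rhs_self:
  assumes "expbd r 1 w"
  shows "expbd r (K5 * \<bar>k\<bar>) (green (rhs k w))"
  using green_bound[OF rhs_bound[OF assms, of k]] by (simp add: K5_def algebra_simps)

lemma green_rhs_lipschitz:
  assumes w: "expbd r 1 w" and w': "expbd r 1 w'" and D: "expbd r D (\<lambda>m. w m - w' m)"
  shows "expbd r (K6 * \<bar>k\<bar> * D) (\<lambda>m. green (rhs k w) m - green (rhs k w') m)"
proof -
  have v: "expbd r (C + 1) (\<lambda>m. \<Phi> m + w m)" and v': "expbd r (C + 1) (\<lambda>m. \<Phi> m + w' m)"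
    by (intro expbd_add expbd_Phi assms)+
  have pd: "pert k (\<lambda>m. \<Phi> m + w m) m - pert k (\<lambda>m. \<Phi> m + w' m) m = pert k (\<lambda>m. w m - w' m) m" for m
    unfolding pert_diff[symmetric] by simp
  have "eps k w - eps k w' = ip (pert k (\<lambda>m. w m - w' m)) / of_real nrm"
    unfolding eps_def diff_divide_distrib[symmetric] ip_diff[OF pert_bound[OF v] pert_bound[OF v'], symmetric] pd
    ..
  moreover have "cmod (ip (pert k (\<lambda>m. w m - w' m))) \<le> Kip * (KB * \<bar>k\<bar> * D)"
    by (intro ip_bound' pert_bound D)
  ultimately have ed: "cmod (eps k w - eps k w') \<le> Kip * (KB * \<bar>k\<bar> * D) / nrm"
    using nrm_pos by (simp add: norm_divide divide_right_mono)
  \<comment> \<open>The difference of the products in \<open>rhs\<close> is split so that first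
    \<open>eps\<close> and then the conjugated factor varies.\<close>
  have "expbd r (Kip * (KB * \<bar>k\<bar> * D) / nrm * (C + 1) + K4 * \<bar>k\<bar> * D + KB * \<bar>k\<bar> * D)
     (\<lambda>m. (eps k w - eps k w') * cnj (\<Phi> m + w m) + eps k w' * cnj (w m - w' m) - pert k (\<lambda>m. w m - w' m) m)"
    by (intro expbd_diff expbd_add expbd_cmult expbd_cnj v D pert_bound ed eps_bound w')
  also have "(\<lambda>m. (eps k w - eps k w') * cnj (\<Phi> m + w m) + eps k w' * cnj (w m - w' m) - pert k (\<lambda>m. w m - w' m) m)
      = (\<lambda>m. rhs k w m - rhs k w' m)"
    unfolding pd[symmetric] rhs_def by (simp add: algebra_simps)
  finally have "expbd r (KG * (Kip * (KB * \<bar>k\<bar> * D) / nrm * (C + 1) + K4 * \<bar>k\<bar> * D + KB * \<bar>k\<bar> * D))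
      (green (\<lambda>m. rhs k w m - rhs k w' m))"
    by (rule green_bound)
  moreover have "green (\<lambda>m. rhs k w m - rhs k w' m) = (\<lambda>m. green (rhs k w) m - green (rhs k w') m)"
    using green_diff[OF rhs_bound[OF w] rhs_bound[OF w']] by blast
  ultimately show ?thesis by (simp add: K6_def algebra_simps)
qed

text \<open>A fixed point \<open>w\<close> of \<open>green (rhs k w)\<close> solves
  \<open>J w = rhs k w\<close>, so \<open>\<Phi> + w\<close> solves the antilinear problem; pairing
  with \<open>\<Phi>\<close> yields the expansion of \<open>\<epsilon>\<close>.\<close>

lemma perturbed_mode_exists:
  assumes S: "ip (dop \<Phi>) - ip (cop \<Phi>) / 2 = of_real S"
  shows "\<exists>\<delta>>0. \<exists>K. \<forall>k. \<bar>k\<bar> < \<delta> \<longrightarrow> (\<exists>f M \<epsilon>. expbd r M f \<and> (\<exists>m. f m \<noteq> 0) \<and>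
           (\<forall>m. jac p q f m + pert k f m = \<epsilon> * cnj (f m)) \<and>
           cmod (\<epsilon> - \<i> * of_real (S / nrm * k)) \<le> K * k\<^sup>2)"
proof -
  \<comment> \<open>For \<open>|k| < \<delta>\<close> this makes \<open>K5 * |k| \<le> 1\<close> and
    \<open>K6 * |k| \<le> 1 / 2\<close>: the iterates stay in the unit ball, and the map contracts
    by one half.\<close>
  define \<delta> where "\<delta> = 1 / (K5 + 2 * K6 + 1)"
  \<comment> \<open>The summands come from the quadratic remainders of \<open>cis k\<close> and
    \<open>cis (- k / 2)\<close> and from the perturbation of order \<open>k\<close> acting on
    \<open>w\<close>, itself of order \<open>k\<close>.\<close>
  define K where "K = (cmod (ip (dop \<Phi>)) + cmod (ip (cop \<Phi>)) / 4 + Kip * KB * K5) / nrm"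
  have "\<delta> > 0" using K_nonneg by (simp add: \<delta>_def)
  moreover have "\<exists>f M \<epsilon>. expbd r M f \<and> (\<exists>m. f m \<noteq> 0) \<and>
           (\<forall>m. jac p q f m + pert k f m = \<epsilon> * cnj (f m)) \<and>
           cmod (\<epsilon> - \<i> * of_real (S / nrm * k)) \<le> K * k\<^sup>2" if k: "\<bar>k\<bar> < \<delta>" for k
  proof -
    have "(K5 + 2 * K6 + 1) * \<bar>k\<bar> \<le> 1"
      using k K_nonneg by (simp add: \<delta>_def field_simps)
    then have "K5 * \<bar>k\<bar> + 2 * (K6 * \<bar>k\<bar>) \<le> 1" by (simp add: algebra_simps)
    then have k5: "K5 * \<bar>k\<bar> \<le> 1" and k6: "K6 * \<bar>k\<bar> \<le> 1 / 2"
      using mult_nonneg_nonneg[OF K_nonneg(2) abs_ge_zero[of k]]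
        mult_nonneg_nonneg[OF K_nonneg(3) abs_ge_zero[of k]] by linarith+
    have one: "expbd r 1 w" if "expbd r (K5 * \<bar>k\<bar>) w" for w
      using expbd_mono[OF that k5] r_pos by simp
    have "\<exists>w. expbd r (K5 * \<bar>k\<bar>) w \<and> green (rhs k w) = w"
    proof (rule expbd_contraction_fixpoint[OF r_pos, of _ "1 / 2"])
      fix w assume "expbd r (K5 * \<bar>k\<bar>) w"
      then show "expbd r (K5 * \<bar>k\<bar>) (green (rhs k w))" by (intro green_rhs_self one)
    next
      fix w w' D
      assume a: "expbd r (K5 * \<bar>k\<bar>) w" "expbd r (K5 * \<bar>k\<bar>) w'" and D: "expbd r D (\<lambda>m. w m - w' m)"
      have "K6 * \<bar>k\<bar> * D \<le> 1 / 2 * D"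
        using k6 expbd_nonneg[OF D] by (rule mult_right_mono)
      then show "expbd r (1 / 2 * D) (\<lambda>m. green (rhs k w) m - green (rhs k w') m)"
        using expbd_mono[OF green_rhs_lipschitz[OF one[OF a(1)] one[OF a(2)] D]] r_pos by simp
    qed (use K_nonneg in auto)
    then obtain w where w5: "expbd r (K5 * \<bar>k\<bar>) w" and fp: "green (rhs k w) = w" by blast
    note w1 = one[OF w5]
    \<comment> \<open>A fixed point lies in the range of \<open>green\<close>, hence is orthogonal
      to \<open>\<Phi>\<close>.\<close>
    have ipw: "ip w = 0" using ip_green[OF rhs_bound[OF w1, of k]] by (simp only: fp)
    have Jw: "jac p q w m = rhs k w m" for m
      using jac_green[OF rhs_bound[OF w1] ip_rhs[OF w1 ipw], of k m] by (simp only: fp)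
    define f where "f = (\<lambda>m. \<Phi> m + w m)"
    have fb: "expbd r (C + 1) f" unfolding f_def by (intro expbd_add expbd_Phi w1)
    have "ip f = of_real nrm" using ip_add[OF expbd_Phi w1] by (simp add: f_def ipw ip_Phi)
    have nz: "\<exists>m. f m \<noteq> 0"
    proof (rule ccontr)
      assume "\<nexists>m. f m \<noteq> 0"
      then have "ip f = 0" by (simp add: ip_def zsum_def lsum_def rsum_def)
      then show False using \<open>ip f = of_real nrm\<close> nrm_pos by simp
    qed
    have eq: "jac p q f m + pert k f m = eps k w * cnj (f m)" for m
    proof -
      have "jac p q f m = jac p q \<Phi> m + jac p q w m" by (simp add: jac_def f_def algebra_simps)
      then show ?thesis by (simp add: jac_Phi Jw rhs_def f_def)
    qed
    have "ip (pert k f) = ip (pert k \<Phi>) + ip (pert k w)"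
      using ip_add[OF pert_bound[OF expbd_Phi] pert_bound[OF w1], of k k]
      by (simp add: f_def pert_add[abs_def])
    moreover have "of_real nrm * eps k w = ip (pert k f)" using nrm_pos by (simp add: eps_def f_def)
    \<comment> \<open>The linear parts \<open>\<i> * k\<close> and \<open>- \<i> * k / 2\<close> of
      the phases combine to \<open>\<i> * S * k\<close>; the right side keeps only terms of second
      order.\<close>
    ultimately have "of_real nrm * eps k w - \<i> * of_real (S * k)
        = (cis k - 1 - \<i> * of_real k) * ip (dop \<Phi>)
          + (cis (- k / 2) - 1 - \<i> * of_real (- k / 2)) * ip (cop \<Phi>) + ip (pert k w)"
      unfolding of_real_mult S[symmetric] by (simp add: ip_pert[OF expbd_Phi] algebra_simps)
    moreover have "cmod ((cis k - 1 - \<i> * of_real k) * ip (dop \<Phi>)) \<le> k\<^sup>2 * cmod (ip (dop \<Phi>))"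
      by (simp only: norm_mult) (intro mult_right_mono cis_minus_linear_bound norm_ge_zero)
    moreover have "cmod ((cis (- k / 2) - 1 - \<i> * of_real (- k / 2)) * ip (cop \<Phi>)) \<le> (- k / 2)\<^sup>2 * cmod (ip (cop \<Phi>))"
      by (simp only: norm_mult) (intro mult_right_mono cis_minus_linear_bound norm_ge_zero)
    moreover have "cmod (ip (pert k w)) \<le> Kip * (KB * \<bar>k\<bar> * (K5 * \<bar>k\<bar>))"
      by (intro ip_bound' pert_bound w5)
    moreover have "Kip * (KB * \<bar>k\<bar> * (K5 * \<bar>k\<bar>)) = Kip * KB * K5 * k\<^sup>2"
      by (simp add: power2_eq_square mult_ac)
    ultimately have "cmod (of_real nrm * eps k w - \<i> * of_real (S * k))
        \<le> k\<^sup>2 * cmod (ip (dop \<Phi>)) + (- k / 2)\<^sup>2 * cmod (ip (cop \<Phi>)) + Kip * KB * K5 * k\<^sup>2"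
      by (smt (verit) norm_triangle_ineq)
    also have "\<dots> = nrm * (K * k\<^sup>2)"
      using nrm_pos by (simp add: K_def field_simps power2_eq_square)
    also have "of_real nrm * eps k w - \<i> * of_real (S * k) = of_real nrm * (eps k w - \<i> * of_real (S / nrm * k))"
      using nrm_pos by (simp add: right_diff_distrib)
    finally have "cmod (eps k w - \<i> * of_real (S / nrm * k)) \<le> K * k\<^sup>2"
      using nrm_pos by (simp add: norm_mult)
    then show ?thesis using fb nz eq by blast
  qed
  ultimately show ?thesis by blast
qed

end

section \<open>First-order coefficient and interface zero mode\<close>

context jacobi_perturbation
begin

text \<open>The first-order form involves only the middle diagonal entries and the intercell bonds.
  By \<open>J \<phi> = 0\<close>, used row by row, it differs from half the sum of
  \<open>q m * (\<phi> m)^2\<close> by a telescoping sum.\<close>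

lemma first_order_coefficient_pos:
  assumes dd: "\<And>m. dd m = (if m mod 3 = 1 then q m else 0)"
    and cc: "\<And>m. cc m = (if m mod 3 = 2 then p m else 0)"
    and q: "\<And>m. q m > 0" "\<And>m. \<bar>q m\<bar> \<le> B" and p: "\<And>m. \<bar>p m\<bar> \<le> B"
  shows "\<exists>S>0. ip (dop \<Phi>) - ip (cop \<Phi>) / 2 = of_real S"
proof -
  \<comment> \<open>The intercell bond gets weight zero and the two bonds within a cell opposite
    halves, which makes the identity \<open>key\<close> hold in every residue class.\<close>
  define e where "e = (\<lambda>m::int. if m mod 3 = 0 then 1 / 2 else if m mod 3 = 1 then - 1 / 2 else 0 :: real)"
  \<comment> \<open>The potential whose differences are the off-diagonal terms left over from the first-order form.\<close>
  define s where "s = (\<lambda>m. complex_of_real (e m * (p m * (\<phi> m * \<phi> (m + 1)))))"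
  define h where "h = (\<lambda>m. q m * (\<phi> m)\<^sup>2 / 2)"
  have eb: "\<bar>e m\<bar> \<le> 1" for m by (simp add: e_def)
  have "\<bar>e m * p m\<bar> \<le> B" for m
    using mult_mono[OF eb[of m] p[of m]] by (simp add: abs_mult)
  then have "expbd r (B * (C / r)) (\<lambda>m. of_real (e m * p m) * \<Phi> (m + 1))"
    by (intro expbd_coeff_mult[OF expbd_shift[OF expbd_Phi r_pos rates(6), of 1]]) simp_all
  from expbd_Phi_mult[OF this]
  have s: "expbd (lam * r) (C * (B * (C / r))) s"
    by (simp add: s_def mult_ac)
  have "expbd r (1 / 2 * (B * C)) (\<lambda>m. 1 / 2 * (of_real (q m) * \<Phi> m))"
    by (rule expbd_cmult[OF expbd_coeff_mult[OF expbd_Phi q(2)]]) simp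
  from expbd_Phi_mult[OF this]
  have h: "expbd (lam * r) (C * (1 / 2 * (B * C))) (\<lambda>m. of_real (h m))"
    by (simp add: h_def power2_eq_square mult_ac)
  have s1: "expbd (lam * r) (C * (B * (C / r)) / (lam * r)) (\<lambda>m. s (m - 1))"
    using expbd_shift[OF s lam_r, of "-1"] by simp
  have key: "\<Phi> m * (dop \<Phi> m - 1 / 2 * cop \<Phi> m) = of_real (h m) + (s m - s (m - 1))" for m
  proof -
    \<comment> \<open>The zero-mode equation trades the bond on the left for the diagonal and the
      bond on the right.\<close>
    have P: "p (m - 1) * \<phi> (m - 1) = - q m * \<phi> m - p m * \<phi> (m + 1)" using phi[of m] by linarith
    have "\<phi> m * (dd m * \<phi> m - 1 / 2 * (cc m * \<phi> (m + 1) + cc (m - 1) * \<phi> (m - 1)))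
        = h m + (e m * (p m * (\<phi> m * \<phi> (m + 1))) - e (m - 1) * (p (m - 1) * (\<phi> (m - 1) * \<phi> m)))"
    proof -
      have "m mod 3 = 0 \<and> (m - 1) mod 3 = 2 \<or> m mod 3 = 1 \<and> (m - 1) mod 3 = 0
        \<or> m mod 3 = 2 \<and> (m - 1) mod 3 = 1" by presburger
      then consider "m mod 3 = 0" "(m - 1) mod 3 = 2" | "m mod 3 = 1" "(m - 1) mod 3 = 0"
        | "m mod 3 = 2" "(m - 1) mod 3 = 1" by blast
      then show ?thesis
      proof cases
        case 1
        have "\<phi> m * (dd m * \<phi> m - 1 / 2 * (cc m * \<phi> (m + 1) + cc (m - 1) * \<phi> (m - 1)))
            = - (1 / 2) * \<phi> m * (p (m - 1) * \<phi> (m - 1))"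
          using 1 by (simp add: dd cc)
        then show ?thesis unfolding P using 1 by (simp add: e_def h_def algebra_simps power2_eq_square)
      next
        case 2
        have "h m + (e m * (p m * (\<phi> m * \<phi> (m + 1))) - e (m - 1) * (p (m - 1) * (\<phi> (m - 1) * \<phi> m)))
            = h m - 1 / 2 * (p m * (\<phi> m * \<phi> (m + 1))) - 1 / 2 * \<phi> m * (p (m - 1) * \<phi> (m - 1))"
          using 2 by (simp add: e_def)
        then show ?thesis unfolding P using 2 by (simp add: dd cc h_def algebra_simps power2_eq_square)
      next
        case 3
        have "h m + (e m * (p m * (\<phi> m * \<phi> (m + 1))) - e (m - 1) * (p (m - 1) * (\<phi> (m - 1) * \<phi> m)))
            = h m + 1 / 2 * \<phi> m * (p (m - 1) * \<phi> (m - 1))"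
          using 3 by (simp add: e_def)
        then show ?thesis unfolding P using 3 by (simp add: dd cc h_def algebra_simps power2_eq_square)
      qed
    qed
    from arg_cong[OF this, of complex_of_real] show ?thesis
      by (simp add: dop_def cop_def s_def)
  qed
  have "ip (dop \<Phi>) - ip (cop \<Phi>) / 2 = ip (\<lambda>m. dop \<Phi> m - 1 / 2 * cop \<Phi> m)"
    unfolding ip_diff[OF dop_bound[OF expbd_Phi] expbd_cmult[OF cop_bound[OF expbd_Phi] order_refl]]
      ip_cmult[OF cop_bound[OF expbd_Phi]] by simp
  also have "\<dots> = zsum (\<lambda>m. of_real (h m)) + zsum (\<lambda>m. s m - s (m - 1))"
    unfolding ip_def key by (rule zsum_add[OF h expbd_diff[OF s s1] lam_r])
  also have "\<dots> = zsum (\<lambda>m. of_real (h m))" by (simp add: zsum_telescope[OF s lam_r])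
  finally have eq: "ip (dop \<Phi>) - ip (cop \<Phi>) / 2 = zsum (\<lambda>m. of_real (h m))" .
  obtain l where "\<phi> l \<noteq> 0" using phi_nonzero by blast
  then have "\<exists>x>0. zsum (\<lambda>m. of_real (h m)) = of_real x"
    using q(1)[of l] by (intro zsum_of_real_pos[OF h lam_r, of l]) (auto simp: h_def less_imp_le[OF q(1)])
  then show ?thesis unfolding eq by blast
qed

end

section \<open>The interface operator at \<open>k = 0\<close> in Jacobi form\<close>

text \<open>The value at \<open>m\<close> sits on the bond between sites \<open>m\<close> and
  \<open>m + 1\<close>. Residue two marks the intercell bonds, and bond \<open>-1\<close> is the
  interface.\<close>

definition jp :: "real \<Rightarrow> real \<Rightarrow> real \<Rightarrow> real \<Rightarrow> real \<Rightarrow> int \<Rightarrow> real" where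
  "jp bp bm dp dm c m = (if m mod 3 = 2 then if m \<ge> 0 then bp + dp else if m = -1 then c else bm + dm
     else if m \<ge> 0 then bp else bm)"

definition jq :: "real \<Rightarrow> real \<Rightarrow> real \<Rightarrow> real \<Rightarrow> int \<Rightarrow> real" where
  "jq bp bm dp dm m = (if m mod 3 = 1 then if m \<ge> 0 then bp + dp else bm + dm
     else if m \<ge> 0 then bp else bm)"

text \<open>The rows start at site \<open>1\<close>, so neither the interface bond nor the left
  coefficients enter. In \<open>jacobi_halfline_left\<close> sites are counted outwards from
  \<open>-1\<close> and the rows start at \<open>-2\<close>.\<close>

lemma jacobi_halfline_right:
  assumes "\<And>m. jp bp bm dp dm c (m - 1) * g (m - 1) + jq bp bm dp dm m * g m
             + jp bp bm dp dm c m * g (m + 1) = 0"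
  shows "halfline bp (bp + dp) (\<lambda>n. g (int n))"
  unfolding halfline_def
proof (intro allI)
  fix n
  have M: "(3 * int n) mod 3 = 0" "(3 * int n + 1) mod 3 = 1" "(3 * int n + 2) mod 3 = 2"
    "(3 * int n + 3) mod 3 = 0" by presburger+
  have e: "int (3 * n) = 3 * int n" "int (3 * n + 1) = 3 * int n + 1" "int (3 * n + 2) = 3 * int n + 2"
    "int (3 * n + 3) = 3 * int n + 3" "int (3 * n + 4) = 3 * int n + 4" by simp_all
  have e': "3 * int n + 1 - 1 = 3 * int n" "3 * int n + 1 + 1 = 3 * int n + 2"
    "3 * int n + 2 - 1 = 3 * int n + 1" "3 * int n + 2 + 1 = 3 * int n + 3"
    "3 * int n + 3 - 1 = 3 * int n + 2" "3 * int n + 3 + 1 = 3 * int n + 4" by simp_all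
  show "bp * g (int (3 * n)) + (bp + dp) * g (int (3 * n + 1)) + bp * g (int (3 * n + 2)) = 0 \<and>
     bp * g (int (3 * n + 1)) + bp * g (int (3 * n + 2)) + (bp + dp) * g (int (3 * n + 3)) = 0 \<and>
     (bp + dp) * g (int (3 * n + 2)) + bp * g (int (3 * n + 3)) + bp * g (int (3 * n + 4)) = 0"
    using assms[of "3 * int n + 1"] assms[of "3 * int n + 2"] assms[of "3 * int n + 3"]
    unfolding e e' by (simp add: jp_def jq_def M)
qed

lemma jacobi_halfline_left:
  assumes "\<And>m. jp bp bm dp dm c (m - 1) * g (m - 1) + jq bp bm dp dm m * g m
             + jp bp bm dp dm c m * g (m + 1) = 0"
  shows "halfline bm (bm + dm) (\<lambda>n. g (- 1 - int n))"
  unfolding halfline_def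
proof (intro allI)
  fix n
  have M: "(- 1 - 3 * int n) mod 3 = 2" "(- 2 - 3 * int n) mod 3 = 1" "(- 3 - 3 * int n) mod 3 = 0"
    "(- 4 - 3 * int n) mod 3 = 2" "(- 5 - 3 * int n) mod 3 = 1" by presburger+
  have e: "- 1 - int (3 * n) = - 1 - 3 * int n" "- 1 - int (3 * n + 1) = - 2 - 3 * int n"
    "- 1 - int (3 * n + 2) = - 3 - 3 * int n" "- 1 - int (3 * n + 3) = - 4 - 3 * int n"
    "- 1 - int (3 * n + 4) = - 5 - 3 * int n" by simp_all
  have e': "- 2 - 3 * int n - 1 = - 3 - 3 * int n" "- 2 - 3 * int n + 1 = - 1 - 3 * int n"
    "- 3 - 3 * int n - 1 = - 4 - 3 * int n" "- 3 - 3 * int n + 1 = - 2 - 3 * int n"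
    "- 4 - 3 * int n - 1 = - 5 - 3 * int n" "- 4 - 3 * int n + 1 = - 3 - 3 * int n" by simp_all
  show "bm * g (- 1 - int (3 * n)) + (bm + dm) * g (- 1 - int (3 * n + 1)) + bm * g (- 1 - int (3 * n + 2)) = 0 \<and>
     bm * g (- 1 - int (3 * n + 1)) + bm * g (- 1 - int (3 * n + 2)) + (bm + dm) * g (- 1 - int (3 * n + 3)) = 0 \<and>
     (bm + dm) * g (- 1 - int (3 * n + 2)) + bm * g (- 1 - int (3 * n + 3)) + bm * g (- 1 - int (3 * n + 4)) = 0"
    using assms[of "- 2 - 3 * int n"] assms[of "- 3 - 3 * int n"] assms[of "- 4 - 3 * int n"]
    unfolding e e' by (simp add: jp_def jq_def M)
qed

text \<open>Every \<open>C\<close> above the threshold works, so one constant can serve the zero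
  mode and the second solution at once. The division by \<open>y\<close> in the threshold is due to
  site \<open>- 1 - n\<close> having distance \<open>n + 1\<close> from the origin.\<close>

lemma two_sided_bound:
  fixes f :: "int \<Rightarrow> real"
  assumes "0 < x" "0 < y" "\<And>n. \<bar>f (int n)\<bar> \<le> A * x ^ n" "\<And>n. \<bar>f (- 1 - int n)\<bar> \<le> A' * y ^ n"
  shows "\<exists>K. \<forall>C\<ge>K. (\<forall>m\<ge>0. \<bar>f m\<bar> \<le> C * x ^ nat \<bar>m\<bar>) \<and> (\<forall>m\<le>0. \<bar>f m\<bar> \<le> C * y ^ nat \<bar>m\<bar>)"
proof (intro exI[of _ "\<bar>A\<bar> + \<bar>A'\<bar> / y"] allI impI conjI)
  fix C m assume C: "\<bar>A\<bar> + \<bar>A'\<bar> / y \<le> C"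
  have n: "0 \<le> \<bar>A'\<bar> / y" using assms(2) by simp
  show "\<bar>f m\<bar> \<le> C * x ^ nat \<bar>m\<bar>" if "m \<ge> 0"
  proof -
    have "\<bar>f m\<bar> \<le> A * x ^ nat m" using assms(3)[of "nat m"] that by simp
    also have "\<dots> \<le> C * x ^ nat m" using C n assms(1) by (intro mult_right_mono) auto
    finally show ?thesis using that by simp
  qed
  show "\<bar>f m\<bar> \<le> C * y ^ nat \<bar>m\<bar>" if "m \<le> 0"
  proof (cases "m = 0")
    case True
    then show ?thesis using assms(3)[of 0] C n by simp
  next
    case False
    define n where "n = nat (- 1 - m)"
    have m: "m = - 1 - int n" "nat \<bar>m\<bar> = Suc n" using that False by (auto simp: n_def)
    have "\<bar>f m\<bar> \<le> A' * y ^ n" using assms(4)[of n] m by simp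
    also have "\<dots> \<le> \<bar>A'\<bar> * y ^ n" using assms(2) by (intro mult_right_mono) auto
    also have "\<dots> = \<bar>A'\<bar> / y * y ^ Suc n" using assms(2) by simp
    also have "\<dots> \<le> C * y ^ Suc n" using C assms(2) by (intro mult_right_mono) auto
    finally show ?thesis using m(2) by simp
  qed
qed

text \<open>Decay of a nonzero solution rules out the parabolic case on each side, so both
  half-lines have a hyperbolic rate; a second solution normalized by the Wronskian then completes
  the locale assumptions.\<close>

lemma interface_zero_mode:
  assumes pos: "bp > 0" "bm > 0" "bp + dp > 0" "bm + dm > 0" "c > 0"
    and phi: "\<And>m. jp bp bm dp dm c (m - 1) * \<phi> (m - 1) + jq bp bm dp dm m * \<phi> m
             + jp bp bm dp dm c m * \<phi> (m + 1) = 0"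
    and nz: "\<phi> l \<noteq> 0"
    and lim: "(\<lambda>n. \<phi> (int n)) \<longlonglongrightarrow> 0" "(\<lambda>n. \<phi> (- 1 - int n)) \<longlonglongrightarrow> 0"
  shows "\<exists>\<psi> lp lm lam r C. jacobi_zero_mode (jp bp bm dp dm c) (jq bp bm dp dm) \<phi> \<psi> lp lm lam r C"
proof -
  let ?p = "jp bp bm dp dm c" and ?q = "jq bp bm dp dm"
  have p: "?p m \<noteq> 0" for m using pos by (simp add: jp_def)
  note hl = jacobi_halfline_right[OF phi] jacobi_halfline_left[OF phi]
  have "bp \<noteq> bp + dp"
  proof
    assume "bp = bp + dp"
    then have "\<phi> (int n) = 0" for n
      using halfline_parabolic[of bp "\<lambda>n. \<phi> (int n)"] hl(1) pos(1) lim(1) by simp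
    from this[of 0] this[of 1] show False
      using jacobi_solution_unique[OF p phi, of 0 l] nz by simp
  qed
  from halfline_dichotomy[OF pos(1,3) this] obtain lp where lp: "0 < lp" "lp < 1"
    "\<And>g. halfline bp (bp + dp) g \<Longrightarrow> \<exists>A. \<forall>n. \<bar>g n\<bar> \<le> A * (1 / lp) ^ n"
    "\<And>g. halfline bp (bp + dp) g \<Longrightarrow> g \<longlonglongrightarrow> 0 \<Longrightarrow> \<exists>A. \<forall>n. \<bar>g n\<bar> \<le> A * lp ^ n"
    by blast
  have "bm \<noteq> bm + dm"
  proof
    assume "bm = bm + dm"
    then have "\<phi> (- 1 - int n) = 0" for n
      using halfline_parabolic[of bm "\<lambda>n. \<phi> (- 1 - int n)"] hl(2) pos(2) lim(2) by simp
    from this[of 0] this[of 1] show False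
      using jacobi_solution_unique[OF p phi, of "-2" l] nz by simp
  qed
  from halfline_dichotomy[OF pos(2,4) this] obtain lm where lm: "0 < lm" "lm < 1"
    "\<And>g. halfline bm (bm + dm) g \<Longrightarrow> \<exists>A. \<forall>n. \<bar>g n\<bar> \<le> A * (1 / lm) ^ n"
    "\<And>g. halfline bm (bm + dm) g \<Longrightarrow> g \<longlonglongrightarrow> 0 \<Longrightarrow> \<exists>A. \<forall>n. \<bar>g n\<bar> \<le> A * lm ^ n"
    by blast
  \<comment> \<open>Initial values proportional to \<open>(- \<phi> 1, \<phi> 0)\<close> give a
    Wronskian proportional to \<open>N\<close>, which is nonzero because two neighbouring zeros
    would force \<open>\<phi> = 0\<close>.\<close>
  define N where "N = (\<phi> 0)\<^sup>2 + (\<phi> 1)\<^sup>2"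
  have "N \<noteq> 0"
    using jacobi_solution_unique[OF p phi, of 0 l] nz by (auto simp: N_def sum_power2_eq_zero_iff)
  obtain \<psi> where psi0: "\<psi> 0 = - \<phi> 1 / (?p 0 * N)" and psi1: "\<psi> 1 = \<phi> 0 / (?p 0 * N)"
    and psi: "\<And>m. ?p (m - 1) * \<psi> (m - 1) + ?q m * \<psi> m + ?p m * \<psi> (m + 1) = 0"
    using jacobi_solution_exists[of ?p, OF p, where a = "- \<phi> 1 / (?p 0 * N)" and b = "\<phi> 0 / (?p 0 * N)" and q = ?q]
    by blast
  have "?p 0 * (\<phi> 0 * \<psi> 1 - \<phi> 1 * \<psi> 0) = 1"
  proof -
    have "\<phi> 0 * \<psi> 1 - \<phi> 1 * \<psi> 0 = N / (?p 0 * N)"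
      unfolding psi0 psi1 by (simp add: N_def power2_eq_square add_divide_distrib)
    then show ?thesis using p[of 0] \<open>N \<noteq> 0\<close> by simp
  qed
  then have W: "?p m * (\<phi> m * \<psi> (m + 1) - \<phi> (m + 1) * \<psi> m) = 1" for m
    using jacobi_wronskian_const[OF phi psi, of m] by simp
  note hl' = jacobi_halfline_right[OF psi] jacobi_halfline_left[OF psi]
  obtain A1 A2 where "\<And>n. \<bar>\<phi> (int n)\<bar> \<le> A1 * lp ^ n" "\<And>n. \<bar>\<phi> (- 1 - int n)\<bar> \<le> A2 * lm ^ n"
    using lp(4)[OF hl(1) lim(1)] lm(4)[OF hl(2) lim(2)] by blast
  from two_sided_bound[OF lp(1) lm(1) this] obtain K1 where K1:
    "\<And>C. C \<ge> K1 \<Longrightarrow> (\<forall>m\<ge>0. \<bar>\<phi> m\<bar> \<le> C * lp ^ nat \<bar>m\<bar>) \<and> (\<forall>m\<le>0. \<bar>\<phi> m\<bar> \<le> C * lm ^ nat \<bar>m\<bar>)" by blast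
  obtain A3 A4 where "\<And>n. \<bar>\<psi> (int n)\<bar> \<le> A3 * (1 / lp) ^ n" "\<And>n. \<bar>\<psi> (- 1 - int n)\<bar> \<le> A4 * (1 / lm) ^ n"
    using lp(3)[OF hl'(1)] lm(3)[OF hl'(2)] by blast
  from two_sided_bound[OF _ _ this] obtain K2 where K2:
    "\<And>C. C \<ge> K2 \<Longrightarrow> (\<forall>m\<ge>0. \<bar>\<psi> m\<bar> \<le> C * (1 / lp) ^ nat \<bar>m\<bar>) \<and> (\<forall>m\<le>0. \<bar>\<psi> m\<bar> \<le> C * (1 / lm) ^ nat \<bar>m\<bar>)"
    using lp(1) lm(1) by auto
  \<comment> \<open>The slower of the two decay rates; the weight \<open>(1 + lam) / 2\<close> then
    lies strictly between \<open>lam\<close> and \<open>1\<close>.\<close>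
  define lam where "lam = max lp lm"
  have lam: "lp \<le> lam" "lm \<le> lam" "lam < 1" using lp(2) lm(2) by (auto simp: lam_def)
  have "jacobi_zero_mode ?p ?q \<phi> \<psi> lp lm lam ((1 + lam) / 2) (max K1 K2)"
    by unfold_locales
      (use lp(1) lm(1) lam phi psi W K1[OF max.cobounded1] K2[OF max.cobounded2] in auto)
  then show ?thesis by blast
qed

section \<open>Translation to the Hamiltonian\<close>

lemma jacobi_interface_coeffs:
  "of_real (jp bp bm dp dm c (3 * n)) = bcoef bp bm n"
  "of_real (jp bp bm dp dm c (3 * n + 1)) = bcoef bp bm n"
  "of_real (jp bp bm dp dm c (3 * n + 2)) = ccoef bp bm dp dm c n"
  "of_real (jp bp bm dp dm c (3 * n - 1)) = ccoef bp bm dp dm c (n - 1)"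
  "of_real (jq bp bm dp dm (3 * n)) = bcoef bp bm n"
  "of_real (jq bp bm dp dm (3 * n + 1)) = dcoef bp bm dp dm n"
  "of_real (jq bp bm dp dm (3 * n + 2)) = bcoef bp bm n"
proof -
  have M: "(3 * n + 1) mod 3 = 1" "(3 * n + 2) mod 3 = 2" "(3 * n - 1) mod 3 = 2" by presburger+
  have O: "3 * n + 1 \<ge> 0 \<longleftrightarrow> n \<ge> 0" "3 * n + 2 \<ge> 0 \<longleftrightarrow> n \<ge> 0" "3 * n + 2 = - 1 \<longleftrightarrow> n = - 1"
    "3 * n - 1 \<ge> 0 \<longleftrightarrow> n - 1 \<ge> 0" "3 * n - 1 = - 1 \<longleftrightarrow> n - 1 = - 1" by presburger+
  show "of_real (jp bp bm dp dm c (3 * n)) = bcoef bp bm n"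
    "of_real (jp bp bm dp dm c (3 * n + 1)) = bcoef bp bm n"
    "of_real (jp bp bm dp dm c (3 * n + 2)) = ccoef bp bm dp dm c n"
    "of_real (jp bp bm dp dm c (3 * n - 1)) = ccoef bp bm dp dm c (n - 1)"
    "of_real (jq bp bm dp dm (3 * n)) = bcoef bp bm n"
    "of_real (jq bp bm dp dm (3 * n + 1)) = dcoef bp bm dp dm n"
    "of_real (jq bp bm dp dm (3 * n + 2)) = bcoef bp bm n"
    unfolding jp_def jq_def bcoef_def ccoef_def dcoef_def M O by auto
qed

section \<open>Summability over the integers\<close>

lemma summable_on_int_imp_halves_tendsto_0:
  fixes h :: "int \<Rightarrow> real"
  assumes "h summable_on UNIV"
  shows "(\<lambda>n. h (int n)) \<longlonglongrightarrow> 0" "(\<lambda>n. h (- 1 - int n)) \<longlonglongrightarrow> 0"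
proof -
  have "(\<lambda>n. h (g n)) \<longlonglongrightarrow> 0" if "inj g" for g :: "nat \<Rightarrow> int"
  proof -
    have "h summable_on range g" using summable_on_subset_banach[OF assms] by blast
    then have "(h \<circ> g) summable_on UNIV" using summable_on_reindex[OF that] by blast
    from summable_LIMSEQ_zero[OF summable_on_imp_summable[OF this]] show ?thesis by (simp add: o_def)
  qed
  from this[of int] this[of "\<lambda>n. - 1 - int n"]
  show "(\<lambda>n. h (int n)) \<longlonglongrightarrow> 0" "(\<lambda>n. h (- 1 - int n)) \<longlonglongrightarrow> 0"
    by (auto simp: inj_def)
qed

lemma power_abs_summable_on_int:
  fixes r :: real
  assumes "0 \<le> r" "r < 1"
  shows "(\<lambda>n. r ^ nat \<bar>n\<bar>) summable_on (UNIV :: int set)"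
proof -
  have s: "summable (\<lambda>n. r ^ n)" using assms by (intro summable_geometric) auto
  have "(\<lambda>n. r ^ nat \<bar>n\<bar>) summable_on range int"
    using assms s
    by (subst summable_on_reindex) (auto simp: o_def intro!: summable_nonneg_imp_summable_on)
  moreover have "(\<lambda>n. r ^ nat \<bar>n\<bar>) summable_on range (\<lambda>n. - 1 - int n)"
  proof (subst summable_on_reindex)
    have "nat \<bar>- 1 - int n\<bar> = Suc n" for n by linarith
    then have "(\<lambda>n. r ^ nat \<bar>n\<bar>) \<circ> (\<lambda>n. - 1 - int n) = (\<lambda>n. r * r ^ n)" by (auto simp: o_def)
    then show "((\<lambda>n. r ^ nat \<bar>n\<bar>) \<circ> (\<lambda>n. - 1 - int n)) summable_on UNIV"
      using assms s by (auto intro!: summable_nonneg_imp_summable_on summable_mult)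
  qed (auto simp: inj_def)
  moreover have "range int \<inter> range (\<lambda>n. - 1 - int n) = {}" by auto
  moreover have "range int \<union> range (\<lambda>n. - 1 - int n) = UNIV"
  proof -
    have "m \<in> range int \<union> range (\<lambda>n. - 1 - int n)" for m
    proof (cases "m \<ge> 0")
      case True
      then have "m = int (nat m)" by simp
      then show ?thesis by blast
    next
      case False
      then have "m = - 1 - int (nat (- 1 - m))" by simp
      then show ?thesis by blast
    qed
    then show ?thesis by blast
  qed
  ultimately show ?thesis using summable_on_Un_disjoint by metis
qed

lemma sum_1_to_6: "(\<Sum>j\<in>{1..6::nat}. g j) = g 1 + g 2 + g 3 + g 4 + g 5 + (g 6 :: real)"
  by (simp add: numeral_eq_Suc atLeastAtMostSuc_conv add_ac)

section \<open>From the Hamiltonian to Jacobi solutions and back\<close>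

lemma HI_components:
  "HI bp bm dp dm c k u n 1 = - bcoef bp bm n * u n 4 - bcoef bp bm n * u n 5
     - ccoef bp bm dp dm c (n - 1) * cis (- k) * u (n - 1) 6"
  "HI bp bm dp dm c k u n 2 = - bcoef bp bm n * u n 4 - dcoef bp bm dp dm n * cis k * u n 5
     - bcoef bp bm n * u n 6"
  "HI bp bm dp dm c k u n 3 = - ccoef bp bm dp dm c n * u (n + 1) 4 - bcoef bp bm n * u n 5
     - bcoef bp bm n * u n 6"
  "HI bp bm dp dm c k u n 4 = - bcoef bp bm n * u n 1 - bcoef bp bm n * u n 2
     - ccoef bp bm dp dm c (n - 1) * u (n - 1) 3"
  "HI bp bm dp dm c k u n 5 = - bcoef bp bm n * u n 1 - dcoef bp bm dp dm n * cis (- k) * u n 2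
     - bcoef bp bm n * u n 3"
  "HI bp bm dp dm c k u n 6 = - ccoef bp bm dp dm c n * cis k * u (n + 1) 1 - bcoef bp bm n * u n 2
     - bcoef bp bm n * u n 3"
  by (simp_all add: HI_def Let_def)

text \<open>Dimension two supplies a nonzero kernel vector. At \<open>k = 0\<close> the triples
  \<open>(1, 2, 3)\<close> and \<open>(4, 5, 6)\<close> decouple and satisfy the same real
  three-term recurrence, so a nonzero real or imaginary part of either triple serves.\<close>

lemma kernel_gives_zero_mode:
  assumes "vector_space.dim sscale (eigsp bp bm dp dm c 0 0) = 2"
  shows "\<exists>\<phi> l. \<phi> l \<noteq> 0 \<and> (\<forall>m. jp bp bm dp dm c (m - 1) * \<phi> (m - 1) + jq bp bm dp dm m * \<phi> m
             + jp bp bm dp dm c m * \<phi> (m + 1) = 0) \<and>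
           (\<lambda>n. \<phi> (int n)) \<longlonglongrightarrow> 0 \<and> (\<lambda>n. \<phi> (- 1 - int n)) \<longlonglongrightarrow> 0"
proof -
  interpret vector_space sscale
    by unfold_locales (auto simp: sscale_def fun_eq_iff algebra_simps)
  have "\<not> eigsp bp bm dp dm c 0 0 \<subseteq> {0}"
  proof
    assume "eigsp bp bm dp dm c 0 0 \<subseteq> {0}"
    then show False using assms dim_le_card[of "eigsp bp bm dp dm c 0 0" "{}"] by simp
  qed
  then obtain u where u: "u \<in> eigsp bp bm dp dm c 0 0" "u \<noteq> 0" by auto
  then have l2: "l2seq u" and H: "HI bp bm dp dm c 0 u = (\<lambda>n j. 0)"
    by (auto simp: eigsp_def sscale_def)
  from u(2) obtain n0 j0 where nz: "u n0 j0 \<noteq> 0" by (auto simp: fun_eq_iff)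
  then have j0: "j0 \<in> {1..6}" using l2 by (auto simp: l2seq_def)
  \<comment> \<open>Selects a triple in which \<open>u\<close> is nonzero; \<open>h\<close> lists
    its components over all cells in one row.\<close>
  define i :: nat where "i = (if j0 \<le> 3 then 1 else 4)"
  define h where "h m = u (m div 3) (nat (m mod 3) + i)" for m
  have hc: "h (3 * n) = u n i" "h (3 * n + 1) = u n (1 + i)" "h (3 * n + 2) = u n (2 + i)"
    "h (3 * n - 1) = u (n - 1) (2 + i)" "h (3 * n + 3) = u (n + 1) i" for n
  proof -
    have "(3 * n + 1) mod 3 = 1" "(3 * n + 1) div 3 = n" "(3 * n + 2) mod 3 = 2" "(3 * n + 2) div 3 = n"
      "(3 * n - 1) mod 3 = 2" "(3 * n - 1) div 3 = n - 1" "(3 * n + 3) mod 3 = 0" "(3 * n + 3) div 3 = n + 1"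
      by presburger+
    then show "h (3 * n) = u n i" "h (3 * n + 1) = u n (1 + i)" "h (3 * n + 2) = u n (2 + i)"
      "h (3 * n - 1) = u (n - 1) (2 + i)" "h (3 * n + 3) = u (n + 1) i" by (simp_all add: h_def)
  qed
  have Hj: "HI bp bm dp dm c 0 u n j = 0" for n j using H by simp
  let ?b = "bcoef bp bm" and ?c = "ccoef bp bm dp dm c" and ?d = "dcoef bp bm dp dm"
  have rows: "?c (n - 1) * u (n - 1) (2 + i) + ?b n * u n i + ?b n * u n (1 + i) = 0"
    "?b n * u n i + ?d n * u n (1 + i) + ?b n * u n (2 + i) = 0"
    "?b n * u n (1 + i) + ?b n * u n (2 + i) + ?c n * u (n + 1) i = 0" for n
  proof -
    have two: "1 + 1 = (2::nat)" "2 + 1 = (3::nat)" "1 + 4 = (5::nat)" "2 + 4 = (6::nat)" by simp_all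
    have "i = 1 \<or> i = 4" by (simp add: i_def)
    then have "- (?c (n - 1) * u (n - 1) (2 + i) + ?b n * u n i + ?b n * u n (1 + i)) = 0 \<and>
        - (?b n * u n i + ?d n * u n (1 + i) + ?b n * u n (2 + i)) = 0 \<and>
        - (?b n * u n (1 + i) + ?b n * u n (2 + i) + ?c n * u (n + 1) i) = 0"
    proof
      assume i: "i = 1"
      show ?thesis unfolding i two
        using Hj[of n 4] Hj[of n 5] Hj[of n 6] unfolding HI_components by (simp add: algebra_simps)
    next
      assume i: "i = 4"
      show ?thesis unfolding i two
        using Hj[of n 1] Hj[of n 2] Hj[of n 3] unfolding HI_components by (simp add: algebra_simps)
    qed
    then show "?c (n - 1) * u (n - 1) (2 + i) + ?b n * u n i + ?b n * u n (1 + i) = 0"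
      "?b n * u n i + ?d n * u n (1 + i) + ?b n * u n (2 + i) = 0"
      "?b n * u n (1 + i) + ?b n * u n (2 + i) + ?c n * u (n + 1) i = 0"
      unfolding neg_equal_0_iff_equal by blast+
  qed
  let ?p = "jp bp bm dp dm c" and ?q = "jq bp bm dp dm"
  have Jh: "jac ?p ?q h m = 0" for m
  proof -
    define n where "n = m div 3"
    have "m = 3 * n \<or> m = 3 * n + 1 \<or> m = 3 * n + 2" unfolding n_def by presburger
    moreover have "jac ?p ?q h (3 * n) = 0"
      using rows(1)[of n] by (simp add: jac_def jacobi_interface_coeffs hc)
    moreover have "jac ?p ?q h (3 * n + 1) = 0"
    proof -
      have "3 * n + 1 - 1 = 3 * n" "3 * n + 1 + 1 = 3 * n + 2" by simp_all
      then show ?thesis unfolding jac_def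
        by (simp only: hc jacobi_interface_coeffs) (rule rows(2)[of n])
    qed
    moreover have "jac ?p ?q h (3 * n + 2) = 0"
    proof -
      have "3 * n + 2 - 1 = 3 * n + 1" "3 * n + 2 + 1 = 3 * n + 3" by simp_all
      then show ?thesis unfolding jac_def
        by (simp only: hc jacobi_interface_coeffs) (rule rows(3)[of n])
    qed
    ultimately show ?thesis by blast
  qed
  define l where "l = 3 * n0 + int (j0 - i)"
  have "h l \<noteq> 0"
  proof -
    have "j0 - i = 0 \<or> j0 - i = 1 \<or> j0 - i = 2" "j0 = j0 - i + i" using j0 by (auto simp: i_def)
    then show ?thesis using nz hc[of n0] by (auto simp: l_def add.commute)
  qed
  have hlim: "(\<lambda>n. cmod (h (int n))) \<longlonglongrightarrow> 0 \<and> (\<lambda>n. cmod (h (- 1 - int n))) \<longlonglongrightarrow> 0"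
  proof -
    define G where "G = (\<lambda>n. \<Sum>j\<in>{1..6}. (cmod (u n j))\<^sup>2)"
    have "G summable_on UNIV" using l2 by (simp add: G_def l2seq_def)
    note lim = summable_on_int_imp_halves_tendsto_0[OF this]
    \<comment> \<open>Each entry is dominated by the norm of its cell, which tends to zero at both
      ends.\<close>
    have bound: "cmod (h m) \<le> sqrt (G (m div 3))" for m
    proof -
      have "nat (m mod 3) + i \<in> {1..6}" by (auto simp: i_def)
      then have "(cmod (h m))\<^sup>2 \<le> G (m div 3)"
        unfolding h_def G_def by (intro member_le_sum[of _ _ "\<lambda>j. (cmod (u (m div 3) j))\<^sup>2"]) auto
      then show ?thesis by (rule real_le_rsqrt)
    qed
    have div3: "filterlim (\<lambda>n::nat. n div 3) at_top sequentially"
      unfolding filterlim_at_top eventually_sequentially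
    proof
      fix Z :: nat
      have "\<forall>n\<ge>3 * Z. Z \<le> n div 3" by auto
      then show "\<exists>N. \<forall>n\<ge>N. Z \<le> n div 3" ..
    qed
    have L: "(\<lambda>n. sqrt (G (int (n div 3)))) \<longlonglongrightarrow> 0" "(\<lambda>n. sqrt (G (- 1 - int (n div 3)))) \<longlonglongrightarrow> 0"
      using tendsto_real_sqrt[OF filterlim_compose[OF lim(1) div3]]
        tendsto_real_sqrt[OF filterlim_compose[OF lim(2) div3]] by simp_all
    have d: "int n div 3 = int (n div 3)" "(- 1 - int n) div 3 = - 1 - int (n div 3)" for n
      by presburger+
    have "cmod (h (int n)) \<le> sqrt (G (int (n div 3)))"
      "cmod (h (- 1 - int n)) \<le> sqrt (G (- 1 - int (n div 3)))" for n
      using bound[of "int n"] bound[of "- 1 - int n"] by (simp_all only: d)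
    then show ?thesis
      by (intro conjI Lim_null_comparison[OF _ L(1)] Lim_null_comparison[OF _ L(2)]) simp_all
  qed
  \<comment> \<open>The coefficients are real, so both parts solve the recurrence; one that is
    nonzero at \<open>l\<close> is kept.\<close>
  define \<phi> where "\<phi> = (\<lambda>m. if Re (h l) \<noteq> 0 then Re (h m) else Im (h m))"
  have "\<phi> l \<noteq> 0" using \<open>h l \<noteq> 0\<close> by (auto simp: \<phi>_def complex_eq_iff)
  moreover have "?p (m - 1) * \<phi> (m - 1) + ?q m * \<phi> m + ?p m * \<phi> (m + 1) = 0" for m
  proof -
    have "Re (jac ?p ?q h m) = 0" "Im (jac ?p ?q h m) = 0" by (simp_all add: Jh)
    then show ?thesis by (auto simp: jac_def \<phi>_def)
  qed
  moreover have le: "norm (\<phi> m) \<le> cmod (h m)" for m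
    by (simp add: \<phi>_def abs_Re_le_cmod abs_Im_le_cmod)
  have "(\<lambda>n. \<phi> (int n)) \<longlonglongrightarrow> 0"
    by (rule Lim_null_comparison[OF always_eventually conjunct1[OF hlim]]) (simp only: le simp_thms)
  moreover have "(\<lambda>n. \<phi> (- 1 - int n)) \<longlonglongrightarrow> 0"
    by (rule Lim_null_comparison[OF always_eventually conjunct2[OF hlim]]) (simp only: le simp_thms)
  ultimately show ?thesis by blast
qed

text \<open>Up to the gauge, components \<open>(1, 2, 3)\<close> are \<open>- \<sigma>\<close> times
  the conjugates of \<open>(4, 5, 6)\<close>. The first three rows of the eigenvalue equation are
  then the given ones and the last three their conjugates, while the sign \<open>\<sigma>\<close>
  moves into the eigenvalue.\<close>

lemma eigenvalue_of_antilinear_mode: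
  fixes E \<sigma> :: real
  assumes f: "expbd r M f" "0 < r" "r < 1" "f l \<noteq> 0" and \<sigma>: "\<sigma> * \<sigma> = 1"
    and row0: "\<And>n. ccoef bp bm dp dm c (n - 1) * cis (- k / 2) * f (3 * n - 1)
        + bcoef bp bm n * f (3 * n) + bcoef bp bm n * f (3 * n + 1) = of_real E * cnj (f (3 * n))"
    and row1: "\<And>n. bcoef bp bm n * f (3 * n) + dcoef bp bm dp dm n * cis k * f (3 * n + 1)
        + bcoef bp bm n * f (3 * n + 2) = of_real E * cnj (f (3 * n + 1))"
    and row2: "\<And>n. bcoef bp bm n * f (3 * n + 1) + bcoef bp bm n * f (3 * n + 2)
        + ccoef bp bm dp dm c n * cis (- k / 2) * f (3 * n + 3) = of_real E * cnj (f (3 * n + 2))"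
  shows "is_eigenvalue bp bm dp dm c k (of_real (\<sigma> * E))"
proof -
  let ?b = "bcoef bp bm" and ?c = "ccoef bp bm dp dm c" and ?d = "dcoef bp bm dp dm"
  \<comment> \<open>The gauge phase: a step to a neighbouring cell changes it by
    \<open>cis (k / 2)\<close> or its inverse, which combines with \<open>cis (- k)\<close> and
    \<open>cis k\<close> to half phases.\<close>
  define g where "g = (\<lambda>n::int. cis (- (k / 2 * of_int n)))"
  have g1: "g (n - 1) = g n * cis (k / 2)" "g (n + 1) = g n * cis (- k / 2)"
    "g (1 + n) = g n * cis (- k / 2)" for n
    by (simp_all add: g_def cis_mult algebra_simps add_divide_distrib diff_divide_distrib)
  have gn: "cmod (g n) = 1" for n by (simp add: g_def)
  define s where "s = complex_of_real \<sigma>"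
  have ss: "s * s = 1" using \<sigma> by (simp add: s_def flip: of_real_mult)
  define u where "u = (\<lambda>(n::int) (j::nat).
      if j = 1 then - s * g n * cnj (f (3 * n)) else if j = 2 then - s * g n * cnj (f (3 * n + 1))
      else if j = 3 then - s * g n * cnj (f (3 * n + 2)) else if j = 4 then g n * f (3 * n)
      else if j = 5 then g n * f (3 * n + 1) else if j = 6 then g n * f (3 * n + 2) else 0)"
  have half: "cis (- k) * cis (k / 2) = cis (- k / 2)" "cis k * cis (- k / 2) = cis (k / 2)"
    by (simp_all add: cis_mult)
  have cb: "cnj (?b n) = ?b n" "cnj (?c n) = ?c n" "cnj (?d n) = ?d n" for n
    by (simp_all add: bcoef_def ccoef_def dcoef_def)
  have c0: "?c (n - 1) * cis (k / 2) * cnj (f (3 * n - 1)) + ?b n * cnj (f (3 * n))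
      + ?b n * cnj (f (3 * n + 1)) = of_real E * f (3 * n)" for n
    using arg_cong[OF row0[of n], of cnj] by (simp add: cb cis_cnj)
  have c1: "?b n * cnj (f (3 * n)) + ?d n * cis (- k) * cnj (f (3 * n + 1)) + ?b n * cnj (f (3 * n + 2))
      = of_real E * f (3 * n + 1)" for n
    using arg_cong[OF row1[of n], of cnj] by (simp add: cb cis_cnj)
  have c2: "?b n * cnj (f (3 * n + 1)) + ?b n * cnj (f (3 * n + 2))
      + ?c n * cis (k / 2) * cnj (f (3 * n + 3)) = of_real E * f (3 * n + 2)" for n
    using arg_cong[OF row2[of n], of cnj] by (simp add: cb cis_cnj)
  have shift: "3 * (n - 1) + 2 = 3 * n - 1" "3 * (n + 1) = 3 * n + 3" for n :: int by simp_all
  have "HI bp bm dp dm c k u n j = of_real (\<sigma> * E) * u n j" for n j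
  proof -
    have "HI bp bm dp dm c k u n 1 = - g n * (?c (n - 1) * (cis (- k) * cis (k / 2)) * f (3 * n - 1)
        + ?b n * f (3 * n) + ?b n * f (3 * n + 1))"
      unfolding HI_components by (simp add: u_def g1 shift algebra_simps)
    also have "\<dots> = - g n * (of_real E * cnj (f (3 * n)))" unfolding half row0 ..
    \<comment> \<open>Inserting \<open>s * s = 1\<close> produces the factor \<open>- s\<close>
      contained in \<open>u\<close>.\<close>
    also have "\<dots> = (s * s) * (- g n * (of_real E * cnj (f (3 * n))))" unfolding ss by simp
    also have "\<dots> = of_real (\<sigma> * E) * u n 1" by (simp add: u_def s_def)
    finally have 1: "HI bp bm dp dm c k u n 1 = of_real (\<sigma> * E) * u n 1" .
    have "HI bp bm dp dm c k u n 2 = - g n * (?b n * f (3 * n) + ?d n * cis k * f (3 * n + 1)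
        + ?b n * f (3 * n + 2))"
      unfolding HI_components by (simp add: u_def algebra_simps)
    also have "\<dots> = - g n * (of_real E * cnj (f (3 * n + 1)))" unfolding row1 ..
    also have "\<dots> = (s * s) * (- g n * (of_real E * cnj (f (3 * n + 1))))" unfolding ss by simp
    also have "\<dots> = of_real (\<sigma> * E) * u n 2" by (simp add: u_def s_def)
    finally have 2: "HI bp bm dp dm c k u n 2 = of_real (\<sigma> * E) * u n 2" .
    have "HI bp bm dp dm c k u n 3 = - g n * (?b n * f (3 * n + 1) + ?b n * f (3 * n + 2)
        + ?c n * cis (- k / 2) * f (3 * n + 3))"
      unfolding HI_components by (simp add: u_def g1 shift algebra_simps)
    also have "\<dots> = - g n * (of_real E * cnj (f (3 * n + 2)))" unfolding row2 ..
    also have "\<dots> = (s * s) * (- g n * (of_real E * cnj (f (3 * n + 2))))" unfolding ss by simp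
    also have "\<dots> = of_real (\<sigma> * E) * u n 3" by (simp add: u_def s_def)
    finally have 3: "HI bp bm dp dm c k u n 3 = of_real (\<sigma> * E) * u n 3" .
    have "HI bp bm dp dm c k u n 4 = s * g n * (?c (n - 1) * cis (k / 2) * cnj (f (3 * n - 1))
        + ?b n * cnj (f (3 * n)) + ?b n * cnj (f (3 * n + 1)))"
      unfolding HI_components by (simp add: u_def g1 shift algebra_simps)
    also have "\<dots> = of_real (\<sigma> * E) * u n 4" unfolding c0 by (simp add: u_def s_def)
    finally have 4: "HI bp bm dp dm c k u n 4 = of_real (\<sigma> * E) * u n 4" .
    have "HI bp bm dp dm c k u n 5 = s * g n * (?b n * cnj (f (3 * n)) + ?d n * cis (- k) * cnj (f (3 * n + 1))
        + ?b n * cnj (f (3 * n + 2)))"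
      unfolding HI_components by (simp add: u_def algebra_simps)
    also have "\<dots> = of_real (\<sigma> * E) * u n 5" unfolding c1 by (simp add: u_def s_def)
    finally have 5: "HI bp bm dp dm c k u n 5 = of_real (\<sigma> * E) * u n 5" .
    have "HI bp bm dp dm c k u n 6 = s * g n * (?b n * cnj (f (3 * n + 1)) + ?b n * cnj (f (3 * n + 2))
        + ?c n * (cis k * cis (- k / 2)) * cnj (f (3 * n + 3)))"
      unfolding HI_components by (simp add: u_def g1 shift algebra_simps)
    also have "\<dots> = of_real (\<sigma> * E) * u n 6" unfolding half c2 by (simp add: u_def s_def)
    finally have 6: "HI bp bm dp dm c k u n 6 = of_real (\<sigma> * E) * u n 6" .
    have 7: "HI bp bm dp dm c k u n j = 0 \<and> u n j = 0" if "j \<notin> {1, 2, 3, 4, 5, 6}"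
      using that by (simp add: HI_def u_def)
    show ?thesis using 1 2 3 4 5 6 7 by (cases "j \<in> {1, 2, 3, 4, 5, 6}") auto
  qed
  then have ev: "HI bp bm dp dm c k u = sscale (of_real (\<sigma> * E)) u"
    by (simp add: sscale_def fun_eq_iff)
  have sn: "cmod s = 1"
  proof -
    have "(\<sigma> - 1) * (\<sigma> + 1) = 0" using \<sigma> by (simp add: algebra_simps)
    then show ?thesis by (auto simp: s_def eq_neg_iff_add_eq_0[symmetric])
  qed
  have fb: "(cmod (f (3 * n + i)))\<^sup>2 \<le> M\<^sup>2 * r ^ nat \<bar>n\<bar>" if "0 \<le> i" "i \<le> 2" for n i
  proof -
    \<comment> \<open>Site \<open>3 * n + i\<close> is at least as far from the origin as
      \<open>n\<close>, so decay per site gives decay per cell.\<close>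
    have "nat \<bar>n\<bar> \<le> nat \<bar>3 * n + i\<bar>" using that by linarith
    then have "r ^ (nat \<bar>3 * n + i\<bar> * 2) \<le> r ^ nat \<bar>n\<bar>"
      using f(2,3) by (intro power_decreasing) auto
    have "(cmod (f (3 * n + i)))\<^sup>2 \<le> (M * r ^ nat \<bar>3 * n + i\<bar>)\<^sup>2"
      using expbdD[OF f(1)] by (intro power_mono) auto
    also have "\<dots> = M\<^sup>2 * r ^ (nat \<bar>3 * n + i\<bar> * 2)" by (simp add: power_mult_distrib power_mult)
    also have "\<dots> \<le> M\<^sup>2 * r ^ nat \<bar>n\<bar>"
      using \<open>r ^ (nat \<bar>3 * n + i\<bar> * 2) \<le> r ^ nat \<bar>n\<bar>\<close> by (intro mult_left_mono) auto
    finally show ?thesis .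
  qed
  have "(\<lambda>n. \<Sum>j\<in>{1..6}. (cmod (u n j))\<^sup>2) summable_on UNIV"
  proof (rule summable_on_comparison_test)
    show "(\<lambda>n. 6 * M\<^sup>2 * r ^ nat \<bar>n\<bar>) summable_on (UNIV :: int set)"
      using f(2,3) by (intro summable_on_cmult_right power_abs_summable_on_int) auto
    fix n :: int
    show "(\<Sum>j\<in>{1..6}. (cmod (u n j))\<^sup>2) \<le> 6 * M\<^sup>2 * r ^ nat \<bar>n\<bar>"
      unfolding sum_1_to_6 using fb[of 0 n] fb[of 1 n] fb[of 2 n]
      by (simp add: u_def norm_mult gn sn)
  qed (auto intro: sum_nonneg)
  then have "l2seq u" by (auto simp: l2seq_def u_def)
  moreover have "u \<noteq> 0"
  proof
    assume "u = 0"
    then have "u n j = 0" for n j by simp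
    from this[of "l div 3" 4] this[of "l div 3" 5] this[of "l div 3" 6]
    have "f (3 * (l div 3)) = 0" "f (3 * (l div 3) + 1) = 0" "f (3 * (l div 3) + 2) = 0"
      using gn[of "l div 3"] by (auto simp: u_def)
    moreover have "l = 3 * (l div 3) \<or> l = 3 * (l div 3) + 1 \<or> l = 3 * (l div 3) + 2" by presburger
    ultimately show False using f(4) by metis
  qed
  ultimately show ?thesis using ev by (auto simp: is_eigenvalue_def eigsp_def)
qed

theorem theorem10:
  fixes bp bm dp dm c :: real
  assumes "bp > 0" and "bm > 0" and "bp + dp > 0" and "bm + dm > 0" and "c > 0"
    and "vector_space.dim sscale (eigsp bp bm dp dm c 0 0) = 2"
  shows "\<exists>E1 > 0. \<exists>\<delta> > 0. \<exists>C. \<exists>Ep Em :: real \<Rightarrow> real.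
           \<forall>k. k \<noteq> 0 \<and> \<bar>k\<bar> < \<delta> \<longrightarrow>
             Ep k \<noteq> Em k \<and>
             is_eigenvalue bp bm dp dm c k (of_real (Ep k)) \<and>
             is_eigenvalue bp bm dp dm c k (of_real (Em k)) \<and>
             \<bar>Ep k - E1 * \<bar>k\<bar>\<bar> \<le> C * k\<^sup>2 \<and>
             \<bar>Em k + E1 * \<bar>k\<bar>\<bar> \<le> C * k\<^sup>2"
proof -
  let ?p = "jp bp bm dp dm c" and ?q = "jq bp bm dp dm"
  obtain \<phi> l where nz: "\<phi> l \<noteq> 0"
    and phi: "\<And>m. ?p (m - 1) * \<phi> (m - 1) + ?q m * \<phi> m + ?p m * \<phi> (m + 1) = 0"
    and lim: "(\<lambda>n. \<phi> (int n)) \<longlonglongrightarrow> 0" "(\<lambda>n. \<phi> (- 1 - int n)) \<longlonglongrightarrow> 0"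
    using kernel_gives_zero_mode[OF assms(6)] by blast
  obtain \<psi> lp lm lam r C where Z: "jacobi_zero_mode ?p ?q \<phi> \<psi> lp lm lam r C"
    using interface_zero_mode[OF assms(1-5) phi nz lim] by blast
  define dd where "dd = (\<lambda>m::int. if m mod 3 = 1 then ?q m else 0)"
  define cc where "cc = (\<lambda>m::int. if m mod 3 = 2 then ?p m else 0)"
  define B where "B = bp + bm + (bp + dp) + (bm + dm) + c"
  have q: "?q m > 0" "\<bar>?q m\<bar> \<le> B" and p: "\<bar>?p m\<bar> \<le> B" for m
    using assms(1-5) by (auto simp: jq_def jp_def B_def)
  have B: "B \<ge> 0" using assms(1-5) by (simp add: B_def)
  interpret jacobi_zero_mode ?p ?q \<phi> \<psi> lp lm lam r C by (rule Z)
  interpret jacobi_perturbation ?p ?q \<phi> \<psi> lp lm lam r C dd cc B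
    by unfold_locales (use q p B in \<open>auto simp: dd_def cc_def\<close>)
  obtain S where S: "S > 0" "ip (dop \<Phi>) - ip (cop \<Phi>) / 2 = of_real S"
    using first_order_coefficient_pos[OF _ _ q p] by (auto simp: dd_def cc_def)
  define E1 where "E1 = S / nrm"
  have E1: "E1 > 0" using S(1) nrm_pos by (simp add: E1_def)
  obtain \<delta> K where \<delta>: "\<delta> > 0" and modes: "\<And>k. \<bar>k\<bar> < \<delta> \<Longrightarrow> \<exists>f M \<epsilon>. expbd r M f \<and> (\<exists>m. f m \<noteq> 0) \<and>
      (\<forall>m. jac ?p ?q f m + pert k f m = \<epsilon> * cnj (f m)) \<and> cmod (\<epsilon> - \<i> * of_real (E1 * k)) \<le> K * k\<^sup>2"
    using perturbed_mode_exists[OF S(2)] unfolding E1_def by blast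
  have ev: "\<exists>E. \<bar>E - E1 * \<bar>k\<bar>\<bar> \<le> K * k\<^sup>2 \<and> is_eigenvalue bp bm dp dm c k (of_real E) \<and>
      is_eigenvalue bp bm dp dm c k (of_real (- E))" if k: "\<bar>k\<bar> < \<delta>" for k
  proof -
    obtain f M \<epsilon> l where f: "expbd r M f" "f l \<noteq> 0"
      and J: "\<And>m. jac ?p ?q f m + pert k f m = \<epsilon> * cnj (f m)"
      and \<epsilon>: "cmod (\<epsilon> - \<i> * of_real (E1 * k)) \<le> K * k\<^sup>2"
      using modes[OF k] by blast
    \<comment> \<open>In an antilinear problem a phase acts on the eigenvalue: replacing
      \<open>f\<close> by \<open>\<omega> * f\<close> multiplies \<open>\<epsilon>\<close> by
      \<open>\<omega>^2\<close>, and half the negative argument turns it into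
      \<open>cmod \<epsilon>\<close>.\<close>
    define \<omega> where "\<omega> = cis (- Arg \<epsilon> / 2)"
    define F where "F = (\<lambda>m. \<omega> * f m)"
    have "cis (Arg \<epsilon>) * (\<omega> * \<omega>) = 1" by (simp add: \<omega>_def cis_mult)
    then have "rcis (cmod \<epsilon>) (Arg \<epsilon>) * (\<omega> * \<omega>) = of_real (cmod \<epsilon>)" by (simp add: rcis_def mult.assoc)
    then have ww: "\<epsilon> * (\<omega> * \<omega>) = of_real (cmod \<epsilon>)" by (simp add: rcis_cmod_Arg)
    have wc: "\<omega> * cnj \<omega> = 1" by (simp add: \<omega>_def cis_cnj cis_mult)
    have JF: "jac ?p ?q F m + pert k F m = of_real (cmod \<epsilon>) * cnj (F m)" for m
    proof -
      have "jac ?p ?q F m + pert k F m = \<omega> * (jac ?p ?q f m + pert k f m)"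
        by (simp add: jac_def pert_def dop_def cop_def F_def algebra_simps)
      also have "\<dots> = \<omega> * (\<omega> * cnj \<omega>) * \<epsilon> * cnj (f m)" unfolding J wc by simp
      also have "\<dots> = (\<epsilon> * (\<omega> * \<omega>)) * cnj (F m)" by (simp add: F_def)
      finally show ?thesis unfolding ww .
    qed
    have Fb: "expbd r (1 * M) F" unfolding F_def by (intro expbd_cmult f(1)) (simp add: \<omega>_def)
    have Fl: "F l \<noteq> 0" using f(2) by (simp add: F_def \<omega>_def)
    have M: "(3 * n) mod 3 = 0" "(3 * n + 1) mod 3 = 1" "(3 * n + 2) mod 3 = 2" "(3 * n - 1) mod 3 = 2"
      for n :: int by presburger+
    have sh: "3 * n + 1 - 1 = 3 * n" "3 * n + 1 + 1 = 3 * n + 2" "3 * n + 2 - 1 = 3 * n + 1"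
      "3 * n + 2 + 1 = 3 * n + 3" for n :: int by simp_all
    have pertF: "pert k F (3 * n) = (cis (- k / 2) - 1) * (of_real (?p (3 * n - 1)) * F (3 * n - 1))"
      "pert k F (3 * n + 1) = (cis k - 1) * (of_real (?q (3 * n + 1)) * F (3 * n + 1))"
      "pert k F (3 * n + 2) = (cis (- k / 2) - 1) * (of_real (?p (3 * n + 2)) * F (3 * n + 3))" for n
      unfolding pert_def dop_def cop_def sh by (simp_all add: dd_def cc_def M)
    have rows:
      "ccoef bp bm dp dm c (n - 1) * cis (- k / 2) * F (3 * n - 1)
        + bcoef bp bm n * F (3 * n) + bcoef bp bm n * F (3 * n + 1) = of_real (cmod \<epsilon>) * cnj (F (3 * n))"
      "bcoef bp bm n * F (3 * n) + dcoef bp bm dp dm n * cis k * F (3 * n + 1)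
        + bcoef bp bm n * F (3 * n + 2) = of_real (cmod \<epsilon>) * cnj (F (3 * n + 1))"
      "bcoef bp bm n * F (3 * n + 1) + bcoef bp bm n * F (3 * n + 2)
        + ccoef bp bm dp dm c n * cis (- k / 2) * F (3 * n + 3) = of_real (cmod \<epsilon>) * cnj (F (3 * n + 2))" for n
      unfolding JF[symmetric] jac_def pertF sh jacobi_interface_coeffs
      by (simp_all add: algebra_simps)
    \<comment> \<open>The same sequence \<open>F\<close> yields both signs of the
      eigenvalue.\<close>
    have "is_eigenvalue bp bm dp dm c k (of_real (\<sigma> * cmod \<epsilon>))" if "\<sigma> * \<sigma> = 1" for \<sigma>
      by (rule eigenvalue_of_antilinear_mode[OF Fb r_pos rates(6) Fl that rows])
    from this[of 1] this[of "-1"]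
    have "is_eigenvalue bp bm dp dm c k (of_real (cmod \<epsilon>))" "is_eigenvalue bp bm dp dm c k (of_real (- cmod \<epsilon>))"
      by simp_all
    moreover have "\<bar>cmod \<epsilon> - E1 * \<bar>k\<bar>\<bar> \<le> K * k\<^sup>2"
    proof -
      have "cmod (\<i> * of_real (E1 * k)) = E1 * \<bar>k\<bar>" using E1 by (simp add: norm_mult abs_mult)
      then show ?thesis using \<epsilon> norm_triangle_ineq3[of \<epsilon> "\<i> * of_real (E1 * k)"] by linarith
    qed
    ultimately show ?thesis by blast
  qed
  then obtain E where E: "\<And>k. \<bar>k\<bar> < \<delta> \<Longrightarrow> \<bar>E k - E1 * \<bar>k\<bar>\<bar> \<le> K * k\<^sup>2 \<and>
      is_eigenvalue bp bm dp dm c k (of_real (E k)) \<and> is_eigenvalue bp bm dp dm c k (of_real (- E k))"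
    by metis
  \<comment> \<open>For nonzero \<open>k\<close> in this range \<open>K * k^2 < E1 * |k|\<close>,
    hence \<open>E k > 0\<close> and the two eigenvalues differ.\<close>
  define \<delta>' where "\<delta>' = min \<delta> (E1 / (\<bar>K\<bar> + 1))"
  have \<delta>': "\<delta>' > 0" using \<delta> E1 by (simp add: \<delta>'_def)
  have key: "E k \<noteq> - E k \<and> is_eigenvalue bp bm dp dm c k (of_real (E k)) \<and>
      is_eigenvalue bp bm dp dm c k (of_real (- E k)) \<and> \<bar>E k - E1 * \<bar>k\<bar>\<bar> \<le> K * k\<^sup>2 \<and>
      \<bar>- E k + E1 * \<bar>k\<bar>\<bar> \<le> K * k\<^sup>2" if k: "k \<noteq> 0 \<and> \<bar>k\<bar> < \<delta>'" for k
  proof -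
    have 1: "\<bar>k\<bar> < \<delta>" "\<bar>k\<bar> * (\<bar>K\<bar> + 1) < E1"
      using k by (auto simp: \<delta>'_def less_divide_eq)
    note Ek = E[OF 1(1)]
    have "K * k\<^sup>2 \<le> (\<bar>K\<bar> + 1) * k\<^sup>2" by (intro mult_right_mono) auto
    also have "\<dots> = \<bar>k\<bar> * (\<bar>K\<bar> + 1) * \<bar>k\<bar>" by (simp add: power2_eq_square)
    also have "\<dots> < E1 * \<bar>k\<bar>" using 1(2) k by (intro mult_strict_right_mono) auto
    finally have "E k > 0" using Ek by linarith
    then show ?thesis using Ek by (auto simp: abs_minus_commute)
  qed
  show ?thesis
    by (rule exI[of _ E1], rule conjI[OF E1], rule exI[of _ \<delta>'], rule conjI[OF \<delta>'], rule exI[of _ K],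
        rule exI[of _ E], rule exI[of _ "\<lambda>k. - E k"], intro allI impI, rule key)
qed

end
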